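(* Let $G\sim G(n,1/2)$. With probability at least $1-O(n^{-1}\mathrm{polylog}\,n)$, $\bar\rho(G)\ge\left(\frac{3\pi}{8}-o(1)\right)\sqrt n$.
   Context: For a graph $G=(V,E)$ on $V=[n]$, $\bar\rho(G)$ is the minimum of $\sigma_1(M)$ (the largest singular value, equivalently the spectral radius, of $M$) over all real symmetric $n\times n$ matrices $M$ with $M_{ii}=0$ for all $i\in V$ and $M_{ij}=1$ for all edges $\{i,j\}\in E$. $G(n,1/2)$ is the Erdős–Rényi random graph. *)

theory Defs
  imports "HOL-Probability.Probability"
begin

definition all_edges :: "nat \<Rightarrow> nat set set" where
  "all_edges n = {{i, j} | i j. i < j \<and> j < n}"

definition gnp_half :: "nat \<Rightarrow> nat set set pmf" where
  "gnp_half n = pmf_of_set (Pow (all_edges n))"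

definition sigma1 :: "nat \<Rightarrow> (nat \<Rightarrow> nat \<Rightarrow> real) \<Rightarrow> real" where
  "sigma1 n M = Sup {sqrt (\<Sum>i<n. (\<Sum>j<n. M i j * x j)\<^sup>2) | x. (\<Sum>j<n. (x j)\<^sup>2) = 1}"

definition admissible :: "nat \<Rightarrow> nat set set \<Rightarrow> (nat \<Rightarrow> nat \<Rightarrow> real) \<Rightarrow> bool" where
  "admissible n E M \<longleftrightarrow>
     (\<forall>i<n. \<forall>j<n. M i j = M j i) \<and> (\<forall>i<n. M i i = 0) \<and>
     (\<forall>i<n. \<forall>j<n. {i, j} \<in> E \<longrightarrow> M i j = 1)"

definition rho_bar :: "nat \<Rightarrow> nat set set \<Rightarrow> real" where
  "rho_bar n E = Inf (sigma1 n ` {M. admissible n E M})"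

end

theory Submission
  imports Defs
begin

text \<open>
  Let \<open>S\<close> be the symmetric sign matrix of the graph (\<open>1\<close> on edges, \<open>-1\<close> on non-edges, \<open>0\<close> on the
  diagonal) and \<open>A\<close> the adjacency matrix. The nuclear norm is dual to \<open>\<sigma>\<^sub>1\<close>, and an admissible \<open>M\<close> equals
  \<open>1\<close> on the support of \<open>A\<close>, so \<open>\<sigma>\<^sub>1(M) \<parallel>A\<parallel>\<^sub>* \<ge> \<langle>M, A\<rangle> = 2 e(G)\<close>, where \<open>\<parallel>A\<parallel>\<^sub>* \<le> n + \<parallel>S\<parallel>\<^sub>* / 2\<close>. Flipping an
  edge changes \<open>\<parallel>S\<parallel>\<^sub>*\<close> by at most \<open>4\<close>, hence its variance is \<open>O(n\<^sup>2)\<close> by the Efron--Stein inequality, and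
  it suffices to bound its mean by \<open>(8/(3\<pi>) + o(1)) n\<^sup>3\<^sup>/\<^sup>2\<close>, as predicted by the semicircle law.

  For the mean let \<open>T\<^sub>k\<close> be \<open>n\<^sup>-\<^sup>k\<^sup>/\<^sup>2\<close> times the matrix of signed self-avoiding walks of length \<open>k\<close>, and
  \<open>H = S / \<surd>n = T\<^sub>1\<close>. The \<open>T\<^sub>k\<close> are exactly orthogonal in mean and \<open>H T\<^sub>k = T\<^sub>k\<^sub>+\<^sub>1 + T\<^sub>k\<^sub>-\<^sub>1 +\<close> an error of bounded
  Frobenius norm, the recurrence of the Chebyshev polynomials \<open>U\<^sub>k\<close> that are orthonormal for the semicircle
  law. So \<open>T\<^sub>a T\<^sub>b\<close> follows the expansion of \<open>U\<^sub>a U\<^sub>b\<close> up to nuclear norm \<open>O(\<surd>n)\<close>. With polynomials \<open>P\<close>, \<open>Q\<close> that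
  approximate \<open>\<surd>|x|\<close> and \<open>sgn(x) \<surd>|x|\<close> on \<open>[-2, 2]\<close> we get \<open>H \<approx> P(T) Q(T)\<close>, and the mean of
  \<open>\<parallel>P(T) Q(T)\<parallel>\<^sub>* \<le> (\<parallel>P(T)\<parallel>\<^sub>F\<^sup>2 + \<parallel>Q(T)\<parallel>\<^sub>F\<^sup>2) / 2\<close> is about \<open>n \<integral>|x| = 8n/(3\<pi>)\<close>,
  the integral taken with respect to the semicircle law.
\<close>

section \<open>The nuclear norm as a dual norm\<close>

definition frob_inner :: "nat \<Rightarrow> (nat \<Rightarrow> nat \<Rightarrow> real) \<Rightarrow> (nat \<Rightarrow> nat \<Rightarrow> real) \<Rightarrow> real" where
  "frob_inner n X Y = (\<Sum>i<n. \<Sum>j<n. X i j * Y i j)"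

definition frob_sq :: "nat \<Rightarrow> (nat \<Rightarrow> nat \<Rightarrow> real) \<Rightarrow> real" where
  "frob_sq n X = (\<Sum>i<n. \<Sum>j<n. (X i j)\<^sup>2)"

definition mat_prod :: "nat \<Rightarrow> (nat \<Rightarrow> nat \<Rightarrow> real) \<Rightarrow> (nat \<Rightarrow> nat \<Rightarrow> real) \<Rightarrow> nat \<Rightarrow> nat \<Rightarrow> real" where
  "mat_prod n X Y i j = (\<Sum>k<n. X i k * Y k j)"

definition contraction :: "nat \<Rightarrow> (nat \<Rightarrow> nat \<Rightarrow> real) \<Rightarrow> bool" where
  "contraction n M \<longleftrightarrow> (\<forall>x. (\<Sum>i<n. (\<Sum>j<n. M i j * x j)\<^sup>2) \<le> (\<Sum>j<n. (x j)\<^sup>2))"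

text \<open>Encoding the nuclear norm by duality makes subadditivity immediate and avoids any
  reference to singular values.\<close>

definition nuc :: "nat \<Rightarrow> (nat \<Rightarrow> nat \<Rightarrow> real) \<Rightarrow> real" where
  "nuc n X = (SUP M\<in>{M. contraction n M}. frob_inner n M X)"

lemma frob_sq_nonneg: "frob_sq n X \<ge> 0"
  unfolding frob_sq_def by (intro sum_nonneg) auto

lemma frob_sq_cong:
  "(\<And>i j. i < n \<Longrightarrow> j < n \<Longrightarrow> X i j = Y i j) \<Longrightarrow> frob_sq n X = frob_sq n Y"
  unfolding frob_sq_def by (intro sum.cong) auto

lemma frob_sq_transpose: "frob_sq n (\<lambda>i j. X j i) = frob_sq n X"
  unfolding frob_sq_def by (rule sum.swap)

lemma frob_sq_diff_le: "frob_sq n (\<lambda>i j. X i j - Y i j) \<le> 2 * (frob_sq n X + frob_sq n Y)"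
proof -
  have "(a - b)\<^sup>2 \<le> 2 * (a\<^sup>2 + b\<^sup>2)" for a b :: real
    using zero_le_power2[of "a + b"] by (simp add: power2_eq_square algebra_simps)
  then show ?thesis
    unfolding frob_sq_def sum_distrib_left sum.distrib[symmetric] by (intro sum_mono) simp
qed

lemma frob_sq_scale: "frob_sq n (\<lambda>i j. c * X i j) = c\<^sup>2 * frob_sq n X"
  unfolding frob_sq_def by (simp add: sum_distrib_left power_mult_distrib)

text \<open>Testing on the \<open>j\<close>-th basis vector bounds the whole column. The bound on
  the entries keeps the supremum in \<open>nuc\<close> finite.\<close>

lemma contraction_entry_le:
  assumes "contraction n M" "i < n" "j < n"
  shows "\<bar>M i j\<bar> \<le> 1"
proof -
  have "(\<Sum>i<n. (\<Sum>k<n. M i k * (if k = j then 1 else 0))\<^sup>2) \<le> (\<Sum>k<n. (if k = j then 1 else 0 :: real)\<^sup>2)"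
    using assms(1)[unfolded contraction_def, rule_format, of "\<lambda>k. if k = j then 1 else 0"] .
  moreover have "(\<Sum>k<n. M i k * (if k = j then 1 else 0)) = M i j" for i
    using assms(3) by (simp add: if_distrib[of "(*) _"] cong: if_cong)
  moreover have "(\<Sum>k<n. (if k = j then 1 else 0 :: real)\<^sup>2) = 1"
    using assms(3) by (simp add: if_distrib[of "\<lambda>x. x\<^sup>2"] cong: if_cong)
  ultimately have "(\<Sum>i<n. (M i j)\<^sup>2) \<le> 1" by simp
  moreover have "(M i j)\<^sup>2 \<le> (\<Sum>i<n. (M i j)\<^sup>2)"
    using assms(2) by (intro member_le_sum) auto
  ultimately have "(M i j)\<^sup>2 \<le> 1" by linarith
  then show ?thesis by (simp add: abs_square_le_1)
qed

lemma frob_inner_le_sum_abs: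
  assumes "contraction n M"
  shows "frob_inner n M X \<le> (\<Sum>i<n. \<Sum>j<n. \<bar>X i j\<bar>)"
  unfolding frob_inner_def
proof (intro sum_mono)
  fix i j assume "i \<in> {..<n}" "j \<in> {..<n}"
  then have "\<bar>M i j * X i j\<bar> \<le> 1 * \<bar>X i j\<bar>"
    unfolding abs_mult using contraction_entry_le[OF assms] by (intro mult_right_mono) auto
  then show "M i j * X i j \<le> \<bar>X i j\<bar>" by linarith
qed

lemma contraction_zero: "contraction n (\<lambda>i j. 0)"
  unfolding contraction_def by (auto intro!: sum_nonneg)

lemma contraction_uminus: "contraction n M \<Longrightarrow> contraction n (\<lambda>i j. - M i j)"
  unfolding contraction_def by (simp add: sum_negf)

lemma frob_inner_le_nuc: "contraction n M \<Longrightarrow> frob_inner n M X \<le> nuc n X"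
  unfolding nuc_def
  by (rule cSUP_upper) (auto intro!: bdd_aboveI2 frob_inner_le_sum_abs)

lemma nuc_leI: "(\<And>M. contraction n M \<Longrightarrow> frob_inner n M X \<le> c) \<Longrightarrow> nuc n X \<le> c"
  unfolding nuc_def using contraction_zero by (intro cSUP_least) auto

lemma nuc_le_sum_abs: "nuc n X \<le> (\<Sum>i<n. \<Sum>j<n. \<bar>X i j\<bar>)"
  by (intro nuc_leI frob_inner_le_sum_abs)

lemma nuc_cong:
  assumes "\<And>i j. i < n \<Longrightarrow> j < n \<Longrightarrow> X i j = Y i j"
  shows "nuc n X = nuc n Y"
proof -
  have "frob_inner n M X = frob_inner n M Y" for M
    unfolding frob_inner_def using assms by (intro sum.cong) auto
  then show ?thesis by (simp add: nuc_def)
qed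

lemma nuc_add_le: "nuc n (\<lambda>i j. X i j + Y i j) \<le> nuc n X + nuc n Y"
proof (rule nuc_leI)
  fix M assume M: "contraction n M"
  have "frob_inner n M (\<lambda>i j. X i j + Y i j) = frob_inner n M X + frob_inner n M Y"
    by (simp add: frob_inner_def distrib_left sum.distrib)
  then show "frob_inner n M (\<lambda>i j. X i j + Y i j) \<le> nuc n X + nuc n Y"
    using frob_inner_le_nuc[OF M, of X] frob_inner_le_nuc[OF M, of Y] by linarith
qed

lemma nuc_scale_le: "nuc n (\<lambda>i j. c * X i j) \<le> \<bar>c\<bar> * nuc n X"
proof (rule nuc_leI)
  fix M assume M: "contraction n M"
  have "frob_inner n M (\<lambda>i j. c * X i j) = c * frob_inner n M X"
    by (simp add: frob_inner_def sum_distrib_left mult_ac)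
  also have "\<dots> \<le> \<bar>c\<bar> * \<bar>frob_inner n M X\<bar>"
    by (metis abs_ge_self abs_mult)
  \<comment> \<open>Contractions are closed under negation, so the supremum also controls the
    absolute value.\<close>
  also have "\<bar>frob_inner n M X\<bar> \<le> nuc n X"
  proof -
    have "frob_inner n (\<lambda>i j. - M i j) X = - frob_inner n M X"
      by (simp add: frob_inner_def sum_negf)
    then show ?thesis
      using frob_inner_le_nuc[OF M, of X] frob_inner_le_nuc[OF contraction_uminus[OF M], of X]
      by linarith
  qed
  finally show "frob_inner n M (\<lambda>i j. c * X i j) \<le> \<bar>c\<bar> * nuc n X"
    by (simp add: mult_left_mono)
qed

lemma nuc_uminus_le: "nuc n (\<lambda>i j. - X i j) \<le> nuc n X"
  using nuc_scale_le[of n "-1" X] by simp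

lemma nuc_diff_le: "nuc n (\<lambda>i j. X i j - Y i j) \<le> nuc n X + nuc n Y"
  using nuc_add_le[of n X "\<lambda>i j. - Y i j"] nuc_uminus_le[of n Y] by simp

section \<open>Nuclear norms of products and of explicit matrices\<close>

lemma sum_mult_le_sqrt:
  fixes f g :: "'a \<Rightarrow> real"
  shows "(\<Sum>i\<in>A. f i * g i) \<le> sqrt (\<Sum>i\<in>A. (f i)\<^sup>2) * sqrt (\<Sum>i\<in>A. (g i)\<^sup>2)"
proof -
  have "(\<Sum>i\<in>A. f i * g i) \<le> (\<Sum>i\<in>A. \<bar>f i\<bar> * \<bar>g i\<bar>)"
    by (intro sum_mono) (metis abs_ge_self abs_mult)
  also have "\<dots> \<le> L2_set f A * L2_set g A"
    by (rule L2_set_mult_ineq)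
  finally show ?thesis by (simp add: L2_set_def)
qed

text \<open>The Hoelder inequality for Schatten norms: group \<open>M\<close> with the transpose of
  \<open>Y\<close>, apply Cauchy-Schwarz over all pairs \<open>(i, k)\<close>, and use that a
  contraction does not increase the Frobenius norm.\<close>

lemma nuc_prod_le: "nuc n (mat_prod n X Y) \<le> sqrt (frob_sq n X) * sqrt (frob_sq n Y)"
proof (rule nuc_leI)
  fix M assume M: "contraction n M"
  have "frob_inner n M (mat_prod n X Y) = (\<Sum>i<n. \<Sum>j<n. \<Sum>k<n. X i k * (M i j * Y k j))"
    unfolding frob_inner_def mat_prod_def by (simp add: sum_distrib_left mult_ac)
  also have "\<dots> = (\<Sum>i<n. \<Sum>k<n. X i k * (\<Sum>j<n. M i j * Y k j))"
    by (subst sum.swap) (simp add: sum_distrib_left)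
  also have "\<dots> = (\<Sum>(i,k)\<in>{..<n} \<times> {..<n}. X i k * (\<Sum>j<n. M i j * Y k j))"
    by (simp add: sum.cartesian_product)
  also have "\<dots> \<le> sqrt (\<Sum>(i,k)\<in>{..<n} \<times> {..<n}. (X i k)\<^sup>2) *
      sqrt (\<Sum>(i,k)\<in>{..<n} \<times> {..<n}. (\<Sum>j<n. M i j * Y k j)\<^sup>2)"
    using sum_mult_le_sqrt[of "\<lambda>(i,k). X i k" "\<lambda>(i,k). \<Sum>j<n. M i j * Y k j" "{..<n} \<times> {..<n}"]
    by (simp add: case_prod_unfold)
  also have "\<dots> = sqrt (frob_sq n X) * sqrt (\<Sum>i<n. \<Sum>k<n. (\<Sum>j<n. M i j * Y k j)\<^sup>2)"
    by (simp add: sum.cartesian_product frob_sq_def)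
  also have "\<dots> \<le> sqrt (frob_sq n X) * sqrt (frob_sq n Y)"
  proof (intro mult_left_mono real_sqrt_le_mono)
    \<comment> \<open>For fixed \<open>k\<close> the inner sums form \<open>M\<close> applied to row
      \<open>k\<close> of \<open>Y\<close>.\<close>
    have "(\<Sum>i<n. \<Sum>k<n. (\<Sum>j<n. M i j * Y k j)\<^sup>2) = (\<Sum>k<n. \<Sum>i<n. (\<Sum>j<n. M i j * Y k j)\<^sup>2)"
      by (rule sum.swap)
    also have "\<dots> \<le> (\<Sum>k<n. \<Sum>j<n. (Y k j)\<^sup>2)"
      by (rule sum_mono) (use M in \<open>auto simp: contraction_def\<close>)
    finally show "(\<Sum>i<n. \<Sum>k<n. (\<Sum>j<n. M i j * Y k j)\<^sup>2) \<le> frob_sq n Y"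
      by (simp add: frob_sq_def)
  qed (simp add: frob_sq_nonneg)
  finally show "frob_inner n M (mat_prod n X Y) \<le> sqrt (frob_sq n X) * sqrt (frob_sq n Y)" .
qed

lemma sqrt_mult_sqrt_le:
  assumes "a \<ge> 0" "b \<ge> 0" "t > 0"
  shows "sqrt a * sqrt b \<le> (t * a + b / t) / 2"
proof -
  have "0 \<le> (sqrt (t * a) - sqrt (b / t))\<^sup>2" by simp
  also have "\<dots> = t * a + b / t - 2 * (sqrt a * sqrt b)"
    using assms by (simp add: power2_diff real_sqrt_mult real_sqrt_divide power_mult_distrib power_divide)
  finally show ?thesis by simp
qed

text \<open>Unlike the product of square roots, this form is linear in the squared Frobenius norms
  and can be averaged term by term; \<open>t\<close> stays free for balancing.\<close>

lemma nuc_prod_le_weighted: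
  "t > 0 \<Longrightarrow> nuc n (mat_prod n X Y) \<le> (t * frob_sq n X + frob_sq n Y / t) / 2"
  using nuc_prod_le[of n X Y] sqrt_mult_sqrt_le[OF frob_sq_nonneg frob_sq_nonneg, of t n X n Y]
  by linarith

definition id_mat :: "nat \<Rightarrow> nat \<Rightarrow> real" where
  "id_mat i j = (if i = j then 1 else 0)"

lemma mat_prod_id_left: "i < n \<Longrightarrow> mat_prod n id_mat X i j = X i j"
  by (simp add: mat_prod_def id_mat_def if_distrib[of "\<lambda>x. x * _"] cong: if_cong)

lemma frob_sq_id: "frob_sq n id_mat = real n"
  by (simp add: frob_sq_def id_mat_def if_distrib[of "\<lambda>x. x\<^sup>2"] cong: if_cong)

lemma nuc_le_frob_sq: "t > 0 \<Longrightarrow> nuc n X \<le> (t * real n + frob_sq n X / t) / 2"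
  using nuc_prod_le_weighted[of t n id_mat X] nuc_cong[of n "mat_prod n id_mat X" X, OF mat_prod_id_left]
  by (simp add: frob_sq_id)

lemma nuc_id_le: "nuc n id_mat \<le> real n"
  using nuc_le_frob_sq[of 1 n id_mat] by (simp add: frob_sq_id)

text \<open>The all-ones matrix has rank one: it is \<open>C\<close> times its transpose, where
  column 0 of \<open>C\<close> is constantly 1 and the rest vanishes. For \<open>n = 0\<close> there
  is no column 0.\<close>

lemma nuc_ones_le: "nuc n (\<lambda>i j. 1) \<le> real n"
proof (cases "n = 0")
  case True
  then show ?thesis using nuc_le_sum_abs[of n "\<lambda>i j. 1"] by simp
next
  case False
  define C where "C = (\<lambda>(i :: nat) (j :: nat). if j = 0 then 1 else 0 :: real)"
  have "mat_prod n C (\<lambda>i j. C j i) = (\<lambda>i j. 1)"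
    using False by (intro ext) (simp add: mat_prod_def C_def if_distrib[of "\<lambda>x. x * _"] cong: if_cong)
  moreover have "frob_sq n C = real n"
    using False by (simp add: frob_sq_def C_def if_distrib[of "\<lambda>x. x\<^sup>2"] cong: if_cong)
  ultimately show ?thesis
    using nuc_prod_le_weighted[of 1 n C "\<lambda>i j. C j i"] frob_sq_transpose[of n C]
    by simp
qed

lemma mat_prod_symmetric_swap:
  assumes "\<And>i j. i < n \<Longrightarrow> j < n \<Longrightarrow> X i j = X j i" "\<And>i j. i < n \<Longrightarrow> j < n \<Longrightarrow> Y i j = Y j i"
    and "i < n" "j < n"
  shows "mat_prod n X Y i j = mat_prod n Y X j i"
  unfolding mat_prod_def using assms by (intro sum.cong) auto

lemma mat_prod_assoc: "mat_prod n (mat_prod n X Y) Z i j = mat_prod n X (mat_prod n Y Z) i j"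
proof -
  have "(\<Sum>k<n. \<Sum>l<n. X i l * Y l k * Z k j) = (\<Sum>l<n. \<Sum>k<n. X i l * Y l k * Z k j)"
    by (rule sum.swap)
  then show ?thesis
    by (simp add: mat_prod_def sum_distrib_left sum_distrib_right mult.assoc)
qed

section \<open>The operator norm and its duality with the nuclear norm\<close>

lemma bdd_above_sigma1:
  fixes n :: nat and M :: "nat \<Rightarrow> nat \<Rightarrow> real"
  shows "bdd_above {sqrt (\<Sum>i<n. (\<Sum>j<n. M i j * x j)\<^sup>2) | x. (\<Sum>j<n. (x j)\<^sup>2) = 1}"
proof (rule bdd_aboveI)
  fix y assume "y \<in> {sqrt (\<Sum>i<n. (\<Sum>j<n. M i j * x j)\<^sup>2) | x. (\<Sum>j<n. (x j)\<^sup>2) = 1}"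
  then obtain x where y: "y = sqrt (\<Sum>i<n. (\<Sum>j<n. M i j * x j)\<^sup>2)" and x: "(\<Sum>j<n. (x j)\<^sup>2) = 1"
    by blast
  have "(\<Sum>j<n. M i j * x j)\<^sup>2 \<le> (\<Sum>j<n. (M i j)\<^sup>2)" for i
    using Cauchy_Schwarz_ineq_sum[of "M i" x "{..<n}"] x by simp
  then show "y \<le> sqrt (frob_sq n M)"
    unfolding y frob_sq_def by (intro real_sqrt_le_mono sum_mono)
qed

lemma sigma1_bound:
  fixes n :: nat and M :: "nat \<Rightarrow> nat \<Rightarrow> real"
  shows "sqrt (\<Sum>i<n. (\<Sum>j<n. M i j * x j)\<^sup>2) \<le> sigma1 n M * sqrt (\<Sum>j<n. (x j)\<^sup>2)"
proof (cases "(\<Sum>j<n. (x j)\<^sup>2) = 0")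
  case True
  then have "\<forall>j<n. x j = 0" by (subst (asm) sum_nonneg_eq_0_iff) auto
  then have "(\<Sum>i<n. (\<Sum>j<n. M i j * x j)\<^sup>2) = 0" by simp
  then show ?thesis using True by simp
next
  case False
  define r where "r = sqrt (\<Sum>j<n. (x j)\<^sup>2)"
  have pos: "(\<Sum>j<n. (x j)\<^sup>2) > 0"
    using False sum_nonneg[of "{..<n}" "\<lambda>j. (x j)\<^sup>2"] by simp
  then have r: "r > 0" "r\<^sup>2 = (\<Sum>j<n. (x j)\<^sup>2)" by (auto simp: r_def)
  have "(\<Sum>j<n. (x j / r)\<^sup>2) = 1"
    using pos r by (simp add: power_divide sum_divide_distrib[symmetric])
  then have "sqrt (\<Sum>i<n. (\<Sum>j<n. M i j * (x j / r))\<^sup>2) \<le> sigma1 n M"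
    unfolding sigma1_def
    by (intro cSup_upper bdd_above_sigma1 CollectI exI[of _ "\<lambda>j. x j / r"]) simp
  moreover have "(\<Sum>i<n. (\<Sum>j<n. M i j * (x j / r))\<^sup>2) = (\<Sum>i<n. (\<Sum>j<n. M i j * x j)\<^sup>2) / r\<^sup>2"
    by (simp add: power_divide sum_divide_distrib[symmetric])
  ultimately have "sqrt (\<Sum>i<n. (\<Sum>j<n. M i j * x j)\<^sup>2) / r \<le> sigma1 n M"
    using r(1) by (simp add: real_sqrt_divide)
  then show ?thesis
    using r(1) by (simp only: pos_divide_le_eq r_def[symmetric])
qed

text \<open>Evaluate \<open>sigma1_bound\<close> at the all-ones vector, which is nonzero because
  \<open>n \<ge> 1\<close>. For \<open>n = 0\<close> there are no unit vectors and
  \<open>sigma1\<close> is the supremum of the empty set.\<close>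

lemma sigma1_nonneg:
  assumes "n \<ge> 1"
  shows "sigma1 n M \<ge> 0"
proof -
  have "sqrt (\<Sum>j<n. (1 :: real)\<^sup>2) > 0" using assms by simp
  moreover have "0 \<le> sigma1 n M * sqrt (\<Sum>j<n. (1 :: real)\<^sup>2)"
    using sigma1_bound[of M "\<lambda>_. 1" n]
    by (rule order_trans[rotated]) (simp add: sum_nonneg)
  ultimately show ?thesis by (simp add: zero_le_mult_iff)
qed

text \<open>Dividing \<open>M\<close> by \<open>sigma1 n M\<close> gives a contraction, which can be
  tested in \<open>nuc\<close>. If the norm vanishes, every multiple of \<open>M\<close> is a
  contraction, which forces all entries to be 0.\<close>

lemma frob_inner_le_sigma1_nuc:
  assumes "n \<ge> 1"
  shows "frob_inner n M X \<le> sigma1 n M * nuc n X"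
proof (cases "sigma1 n M = 0")
  case True
  have "contraction n (\<lambda>i j. t * M i j)" for t
    unfolding contraction_def
  proof
    fix x
    have "(\<Sum>i<n. (\<Sum>j<n. M i j * x j)\<^sup>2) \<le> 0"
      using sigma1_bound[of M x n] True by simp
    then have "(\<Sum>i<n. (\<Sum>j<n. t * M i j * x j)\<^sup>2) \<le> 0"
      by (simp add: mult.assoc sum_distrib_left[symmetric] power_mult_distrib mult_nonneg_nonpos)
    then show "(\<Sum>i<n. (\<Sum>j<n. t * M i j * x j)\<^sup>2) \<le> (\<Sum>j<n. (x j)\<^sup>2)"
      by (rule order_trans) (simp add: sum_nonneg)
  qed
  \<comment> \<open>The factor would scale a nonzero entry to 2, above the bound 1 for entries of a
    contraction.\<close>
  then have "contraction n (\<lambda>k l. (2 / M i j) * M k l)" for i j .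
  then have "M i j = 0" if "i < n" "j < n" for i j
    using contraction_entry_le[of n "\<lambda>k l. (2 / M i j) * M k l" i j] that by (cases "M i j = 0") auto
  then show ?thesis using True by (simp add: frob_inner_def)
next
  case False
  then have s: "sigma1 n M > 0" using sigma1_nonneg[OF assms, of M] by simp
  have "contraction n (\<lambda>i j. M i j / sigma1 n M)"
    unfolding contraction_def
  proof
    fix x
    have "(\<Sum>i<n. (\<Sum>j<n. M i j * x j)\<^sup>2) \<le> (sigma1 n M * sqrt (\<Sum>j<n. (x j)\<^sup>2))\<^sup>2"
      using sigma1_bound[of M x n] by (rule sqrt_le_D)
    also have "\<dots> = (sigma1 n M)\<^sup>2 * (\<Sum>j<n. (x j)\<^sup>2)"
      by (simp add: power_mult_distrib sum_nonneg)
    finally show "(\<Sum>i<n. (\<Sum>j<n. M i j / sigma1 n M * x j)\<^sup>2) \<le> (\<Sum>j<n. (x j)\<^sup>2)"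
      using s by (simp add: power_divide sum_divide_distrib[symmetric] field_simps)
  qed
  then have "frob_inner n (\<lambda>i j. M i j / sigma1 n M) X \<le> nuc n X"
    by (rule frob_inner_le_nuc)
  moreover have "frob_inner n (\<lambda>i j. M i j / sigma1 n M) X = frob_inner n M X / sigma1 n M"
    by (simp add: frob_inner_def sum_divide_distrib)
  ultimately show ?thesis using s by (simp add: field_simps)
qed

section \<open>Averages over the discrete cube\<close>

text \<open>A finite sum in place of an integral over \<open>pmf_of_set (Pow A)\<close>, so no
  integrability conditions arise.\<close>

definition avg :: "'a set \<Rightarrow> ('a set \<Rightarrow> real) \<Rightarrow> real" where
  "avg A f = (\<Sum>E\<in>Pow A. f E) / 2 ^ card A"

lemma avg_add: "avg A (\<lambda>E. f E + g E) = avg A f + avg A g"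
  by (simp add: avg_def sum.distrib add_divide_distrib)

lemma avg_cmult: "avg A (\<lambda>E. c * f E) = c * avg A f"
  by (simp add: avg_def sum_distrib_left)

lemma avg_divide: "avg A (\<lambda>E. f E / c) = avg A f / c"
  by (simp add: avg_def sum_divide_distrib mult.commute)

lemma avg_sum: "avg A (\<lambda>E. \<Sum>i\<in>I. f i E) = (\<Sum>i\<in>I. avg A (f i))"
  unfolding avg_def by (subst sum.swap) (simp add: sum_divide_distrib)

lemma avg_const: "finite A \<Longrightarrow> avg A (\<lambda>E. c) = c"
  by (simp add: avg_def card_Pow)

lemma avg_mono: "(\<And>E. E \<subseteq> A \<Longrightarrow> f E \<le> g E) \<Longrightarrow> avg A f \<le> avg A g"
  unfolding avg_def by (intro divide_right_mono sum_mono) auto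

lemma avg_cong: "(\<And>E. E \<subseteq> A \<Longrightarrow> f E = g E) \<Longrightarrow> avg A f = avg A g"
  unfolding avg_def by (intro arg_cong2[where f = "(/)"] sum.cong) auto

text \<open>Conditioning on the membership of \<open>e\<close>; this drives both the orthogonality
  of the characters and the Efron-Stein induction.\<close>

lemma avg_insert:
  assumes "finite A" "e \<notin> A"
  shows "avg (insert e A) f = avg A (\<lambda>E. (f E + f (insert e E)) / 2)"
proof -
  have "(\<Sum>E\<in>Pow (insert e A). f E) = (\<Sum>E\<in>Pow A. f E) + (\<Sum>E\<in>insert e ` Pow A. f E)"
    unfolding Pow_insert using assms by (intro sum.union_disjoint) auto
  also have "(\<Sum>E\<in>insert e ` Pow A. f E) = (\<Sum>E\<in>Pow A. f (insert e E))"
    using assms(2) by (subst sum.reindex) (auto simp: inj_on_def)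
  finally show ?thesis
    using assms by (simp add: avg_def sum.distrib sum_divide_distrib[symmetric] field_simps)
qed

section \<open>Walsh characters on the discrete cube\<close>

definition spin :: "'a set \<Rightarrow> 'a \<Rightarrow> real" where
  "spin E e = (if e \<in> E then 1 else -1)"

lemma spin_square [simp]: "spin E e * spin E e = 1"
  by (simp add: spin_def)

text \<open>Toggling one element of a nonempty \<open>D\<close> reverses the sign of the product, so
  the two values cancel.\<close>

lemma avg_prod_spin:
  assumes "finite A" "D \<subseteq> A"
  shows "avg A (\<lambda>E. \<Prod>e\<in>D. spin E e) = of_bool (D = {})"
proof (cases "D = {}")
  case True
  then show ?thesis using assms by (simp add: avg_const)
next
  case False
  then obtain e where e: "e \<in> D" by blast
  define A' where "A' = A - {e}"
  have A: "A = insert e A'" "e \<notin> A'" "finite A'" using e assms by (auto simp: A'_def)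
  have fin: "finite D" using assms by (rule finite_subset[rotated])
  have "avg A (\<lambda>E. \<Prod>e\<in>D. spin E e) =
      avg A' (\<lambda>E. ((\<Prod>e\<in>D. spin E e) + (\<Prod>d\<in>D. spin (insert e E) d)) / 2)"
    using A by (simp add: avg_insert)
  also have "\<dots> = avg A' (\<lambda>E. 0)"
  proof (rule avg_cong)
    fix E assume "E \<subseteq> A'"
    then have "e \<notin> E" using A by blast
    have "(\<Prod>d\<in>D - {e}. spin (insert e E) d) = (\<Prod>d\<in>D - {e}. spin E d)"
      by (intro prod.cong) (auto simp: spin_def)
    then show "((\<Prod>e\<in>D. spin E e) + (\<Prod>d\<in>D. spin (insert e E) d)) / 2 = 0"
      using \<open>e \<notin> E\<close> by (simp add: prod.remove[OF fin e] spin_def)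
  qed
  also have "\<dots> = 0" using A by (simp add: avg_const)
  finally show ?thesis using False by simp
qed

text \<open>Spins square to 1, so the common factor over the intersection cancels and the product is
  the character of the symmetric difference.\<close>

lemma avg_prod_spin_mult:
  assumes "finite A" "C \<subseteq> A" "D \<subseteq> A"
  shows "avg A (\<lambda>E. (\<Prod>e\<in>C. spin E e) * (\<Prod>e\<in>D. spin E e)) = of_bool (C = D)"
proof -
  have fin: "finite C" "finite D" using assms finite_subset by blast+
  have "(\<Prod>e\<in>C. spin E e) * (\<Prod>e\<in>D. spin E e) = (\<Prod>e\<in>(C - D) \<union> (D - C). spin E e)" for E
  proof -
    have "(\<Prod>e\<in>C. spin E e) = (\<Prod>e\<in>C - D. spin E e) * (\<Prod>e\<in>C \<inter> D. spin E e)"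
      using fin by (subst prod.union_disjoint[symmetric]) (auto intro: arg_cong2[where f = prod])
    moreover have "(\<Prod>e\<in>D. spin E e) = (\<Prod>e\<in>D - C. spin E e) * (\<Prod>e\<in>C \<inter> D. spin E e)"
      using fin by (subst prod.union_disjoint[symmetric]) (auto intro: arg_cong2[where f = prod])
    moreover have "(\<Prod>e\<in>C \<inter> D. spin E e) * (\<Prod>e\<in>C \<inter> D. spin E e) = 1"
      by (simp flip: prod.distrib)
    moreover have "(\<Prod>e\<in>(C - D) \<union> (D - C). spin E e) = (\<Prod>e\<in>C - D. spin E e) * (\<Prod>e\<in>D - C. spin E e)"
      using fin by (intro prod.union_disjoint) auto
    ultimately show ?thesis by (simp add: ac_simps)
  qed
  then have "avg A (\<lambda>E. (\<Prod>e\<in>C. spin E e) * (\<Prod>e\<in>D. spin E e)) = of_bool ((C - D) \<union> (D - C) = {})"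
    using avg_prod_spin[of A "(C - D) \<union> (D - C)"] assms by (simp add: subset_iff)
  also have "((C - D) \<union> (D - C) = {}) \<longleftrightarrow> C = D" by blast
  finally show ?thesis .
qed

text \<open>Induction on the coordinates. Averaging \<open>f\<close> over the membership of
  \<open>e\<close> gives \<open>g\<close>, which inherits the difference bound; the variance lost is
  the mean of \<open>((f (insert e E) - f E) / 2)\<^sup>2\<close>, at most
  \<open>c\<^sup>2 / 4\<close>.\<close>

lemma efron_stein:
  assumes "finite A" "\<And>e E. e \<in> A \<Longrightarrow> E \<subseteq> A \<Longrightarrow> \<bar>f (insert e E) - f E\<bar> \<le> c"
  shows "avg A (\<lambda>E. (f E)\<^sup>2) - (avg A f)\<^sup>2 \<le> real (card A) * c\<^sup>2 / 4"
  using assms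
proof (induction A arbitrary: f rule: finite_induct)
  case empty
  then show ?case by (simp add: avg_def)
next
  case (insert e A)
  define g where "g = (\<lambda>E. (f E + f (insert e E)) / 2)"
  have "avg A (\<lambda>E. (g E)\<^sup>2) - (avg A g)\<^sup>2 \<le> real (card A) * c\<^sup>2 / 4"
  proof (rule insert.IH)
    fix d E assume "d \<in> A" "E \<subseteq> A"
    then have "\<bar>f (insert d E) - f E\<bar> \<le> c" "\<bar>f (insert d (insert e E)) - f (insert e E)\<bar> \<le> c"
      by (auto intro!: insert.prems)
    then show "\<bar>g (insert d E) - g E\<bar> \<le> c"
      by (auto simp: g_def insert_commute[of e d] abs_le_iff field_simps)
  qed
  moreover have "avg (insert e A) (\<lambda>E. (f E)\<^sup>2) \<le> avg A (\<lambda>E. (g E)\<^sup>2 + c\<^sup>2 / 4)"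
    unfolding avg_insert[OF insert.hyps(1,2)]
  proof (rule avg_mono)
    fix E assume "E \<subseteq> A"
    then have "\<bar>f (insert e E) - f E\<bar> \<le> c" by (intro insert.prems) auto
    then have "(f (insert e E) - f E)\<^sup>2 \<le> c\<^sup>2" by (metis abs_ge_zero power2_abs power_mono)
    then show "((f E)\<^sup>2 + (f (insert e E))\<^sup>2) / 2 \<le> (g E)\<^sup>2 + c\<^sup>2 / 4"
      by (simp add: g_def power2_eq_square field_simps)
  qed
  moreover have "avg (insert e A) f = avg A g"
    unfolding g_def by (rule avg_insert[OF insert.hyps(1,2)])
  moreover have "avg A (\<lambda>E. (g E)\<^sup>2 + c\<^sup>2 / 4) = avg A (\<lambda>E. (g E)\<^sup>2) + c\<^sup>2 / 4"
    using insert.hyps by (simp add: avg_add avg_const)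
  ultimately show ?case
    using insert.hyps by (simp add: field_simps)
qed

text \<open>Chebyshev's inequality for the upper tail, with the variance bounded by
  \<open>efron_stein\<close>.\<close>

lemma chebyshev_bounded_difference:
  assumes "finite A" "\<And>e E. e \<in> A \<Longrightarrow> E \<subseteq> A \<Longrightarrow> \<bar>f (insert e E) - f E\<bar> \<le> c" "t > 0"
  shows "measure_pmf.prob (pmf_of_set (Pow A)) {E. f E > avg A f + t} \<le> real (card A) * c\<^sup>2 / (4 * t\<^sup>2)"
proof -
  let ?X = "{E. f E > avg A f + t}"
  have "measure_pmf.prob (pmf_of_set (Pow A)) ?X = real (card (Pow A \<inter> ?X)) / real (card (Pow A))"
    using assms(1) by (intro measure_pmf_of_set) auto
  also have "\<dots> = avg A (\<lambda>E. of_bool (E \<in> ?X))"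
    using assms(1) by (simp add: avg_def card_Pow sum.If_cases of_bool_def)
  finally have prob: "measure_pmf.prob (pmf_of_set (Pow A)) ?X = avg A (\<lambda>E. of_bool (E \<in> ?X))" .
  have "t\<^sup>2 * avg A (\<lambda>E. of_bool (E \<in> ?X)) = avg A (\<lambda>E. t\<^sup>2 * of_bool (E \<in> ?X))"
    by (simp add: avg_cmult)
  also have "\<dots> \<le> avg A (\<lambda>E. (f E - avg A f)\<^sup>2)"
  proof (rule avg_mono)
    fix E
    show "t\<^sup>2 * of_bool (E \<in> ?X) \<le> (f E - avg A f)\<^sup>2"
      using assms(3) by (cases "E \<in> ?X") (auto intro: power_mono)
  qed
  also have "\<dots> = avg A (\<lambda>E. (f E)\<^sup>2 + ((-2 * avg A f) * f E + (avg A f)\<^sup>2))"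
    by (rule avg_cong) (simp add: power2_eq_square algebra_simps)
  also have "\<dots> = avg A (\<lambda>E. (f E)\<^sup>2) - (avg A f)\<^sup>2"
    using assms(1) unfolding avg_add avg_cmult by (simp add: avg_const power2_eq_square)
  also have "\<dots> \<le> real (card A) * c\<^sup>2 / 4"
    using assms by (intro efron_stein)
  finally show ?thesis
    unfolding prob using assms(3) by (simp add: field_simps)
qed

section \<open>Self-avoiding walks\<close>

fun path_edges :: "'a list \<Rightarrow> 'a set set" where
  "path_edges (x # y # ys) = insert {x, y} (path_edges (y # ys))"
| "path_edges xs = {}"

lemma finite_path_edges: "finite (path_edges xs)"
  by (induction xs rule: path_edges.induct) auto

lemma path_edges_subset: "e \<in> path_edges xs \<Longrightarrow> e \<subseteq> set xs"
  by (induction xs rule: path_edges.induct) auto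

lemma Union_path_edges: "length xs \<ge> 2 \<Longrightarrow> \<Union>(path_edges xs) = set xs"
proof (induction xs rule: path_edges.induct)
  case (1 x y ys)
  then show ?case by (cases ys) auto
qed auto

lemma path_edges_append: "path_edges (xs @ [y, z]) = insert {y, z} (path_edges (xs @ [y]))"
proof (induction xs)
  case (Cons x xs)
  then show ?case by (cases xs) auto
qed auto

lemma path_edges_rev: "path_edges (rev xs) = path_edges xs"
proof (induction xs rule: path_edges.induct)
  case (1 x y ys)
  then show ?case using path_edges_append[of "rev ys" y x] by (simp add: insert_commute)
qed auto

lemma pair_in_all_edges: "i < n \<Longrightarrow> j < n \<Longrightarrow> i \<noteq> j \<Longrightarrow> {i, j} \<in> all_edges n"
proof (induction i j rule: linorder_wlog)
  case (le i j)
  then have "i < j \<and> j < n" by simp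
  then show ?case unfolding all_edges_def by blast
next
  case (sym i j)
  then show ?case by (metis insert_commute)
qed

lemma all_edges_subset: "all_edges n \<subseteq> (\<lambda>(i, j). {i, j}) ` ({..<n} \<times> {..<n})"
  by (auto simp: all_edges_def image_iff)

lemma finite_all_edges: "finite (all_edges n)"
  by (rule finite_subset[OF all_edges_subset]) simp

lemma card_all_edges_le: "card (all_edges n) \<le> n\<^sup>2"
proof -
  have "card (all_edges n) \<le> card ({..<n} \<times> {..<n})"
    by (rule surj_card_le[OF _ all_edges_subset]) simp
  then show ?thesis by (simp add: power2_eq_square)
qed

lemma path_edges_subset_all_edges:
  "distinct xs \<Longrightarrow> set xs \<subseteq> {..<n} \<Longrightarrow> path_edges xs \<subseteq> all_edges n"
  by (induction xs rule: path_edges.induct) (auto simp: pair_in_all_edges)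

lemma path_edges_Diff_first:
  assumes "x \<notin> set (y # ys)"
  shows "path_edges (y # ys) = path_edges (x # y # ys) - {{x, y}}"
proof -
  have "{x, y} \<notin> path_edges (y # ys)"
    using path_edges_subset[of "{x, y}" "y # ys"] assms by blast
  then show ?thesis by simp
qed

text \<open>If there is an edge at all, the first vertex of a simple path lies on exactly one, so
  the edge set determines the second vertex; remove that edge and repeat. Fixing the start excludes
  the reversed path.\<close>

lemma path_edges_inj:
  assumes "distinct xs" "distinct ys" "xs \<noteq> []" "ys \<noteq> []" "hd xs = hd ys" "path_edges xs = path_edges ys"
  shows "xs = ys"
  using assms
proof (induction xs arbitrary: ys rule: path_edges.induct)
  case (1 x x' xs)
  obtain y' ys' where ys: "ys = x # y' # ys'"
    using "1.prems" by (metis hd_Cons_tl insert_not_empty list.sel(1) path_edges.simps(1,3))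
  have "{x, y'} \<in> path_edges (x # x' # xs)" using "1.prems"(6) ys by simp
  then have "{x, y'} = {x, x'} \<or> x \<in> set (x' # xs)"
    using path_edges_subset[of "{x, y'}" "x' # xs"] by auto
  then have y': "y' = x'" using "1.prems"(1) by (auto simp: doubleton_eq_iff)
  have "path_edges (x' # xs) = path_edges (y' # ys')"
    using "1.prems" path_edges_Diff_first[of x x' xs] path_edges_Diff_first[of x y' ys']
    unfolding ys y' by (metis distinct.simps(2))
  then show ?case using "1.IH"[of "y' # ys'"] "1.prems" ys y' by auto
next
  case ("2_2" v)
  then show ?case by (cases ys rule: path_edges.cases) auto
qed auto

definition path_weight :: "nat set set \<Rightarrow> nat list \<Rightarrow> real" where
  "path_weight E xs = (\<Prod>e\<in>path_edges xs. spin E e)"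

definition sign_mat :: "nat set set \<Rightarrow> nat \<Rightarrow> nat \<Rightarrow> real" where
  "sign_mat E i j = (if i = j then 0 else spin E {i, j})"

text \<open>The index \<open>k\<close> counts steps, one less than the number of vertices.\<close>

definition simple_paths :: "nat \<Rightarrow> nat \<Rightarrow> nat list set" where
  "simple_paths n k = {xs. length xs = Suc k \<and> distinct xs \<and> set xs \<subseteq> {..<n}}"

definition saw :: "nat \<Rightarrow> nat \<Rightarrow> nat \<Rightarrow> nat \<Rightarrow> nat list set" where
  "saw n k i j = {xs \<in> simple_paths n k. hd xs = i \<and> last xs = j}"

definition saw_sum :: "nat \<Rightarrow> nat \<Rightarrow> nat set set \<Rightarrow> nat \<Rightarrow> nat \<Rightarrow> real" where
  "saw_sum n k E i j = (\<Sum>xs\<in>saw n k i j. path_weight E xs)"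

lemma simple_paths_subset: "simple_paths n k \<subseteq> {xs. set xs \<subseteq> {..<n} \<and> length xs = Suc k}"
  by (auto simp: simple_paths_def)

lemma finite_simple_paths: "finite (simple_paths n k)"
  by (rule finite_subset[OF simple_paths_subset]) (simp add: finite_lists_length_eq)

lemma card_simple_paths_le: "card (simple_paths n k) \<le> n ^ Suc k"
  using card_mono[OF _ simple_paths_subset, of n k]
  by (simp add: finite_lists_length_eq card_lists_length_eq)

lemma finite_saw: "finite (saw n k i j)"
  unfolding saw_def using finite_simple_paths by simp

lemma saw_path_edges: "xs \<in> saw n k i j \<Longrightarrow> path_edges xs \<subseteq> all_edges n"
  by (simp add: saw_def simple_paths_def path_edges_subset_all_edges)

lemma saw_sum_0: "i < n \<Longrightarrow> j < n \<Longrightarrow> saw_sum n 0 E i j = id_mat i j"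
proof -
  assume "i < n" "j < n"
  then have "saw n 0 i j = (if i = j then {[i]} else {})"
    by (auto simp: saw_def simple_paths_def length_Suc_conv)
  then show ?thesis by (simp add: saw_sum_def id_mat_def path_weight_def)
qed

lemma saw_sum_1: "i < n \<Longrightarrow> j < n \<Longrightarrow> saw_sum n 1 E i j = sign_mat E i j"
proof -
  assume "i < n" "j < n"
  then have "saw n 1 i j = (if i = j then {} else {[i, j]})"
    by (auto simp: saw_def simple_paths_def length_Suc_conv)
  then show ?thesis by (simp add: saw_sum_def sign_mat_def path_weight_def)
qed

lemma saw_sum_symmetric: "saw_sum n k E i j = saw_sum n k E j i"
  unfolding saw_sum_def
proof (rule sum.reindex_bij_witness[where i = rev and j = rev])
  fix xs
  show "path_weight E (rev xs) = path_weight E xs" by (simp add: path_weight_def path_edges_rev)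
  show "xs \<in> saw n k i j \<Longrightarrow> rev xs \<in> saw n k j i" "xs \<in> saw n k j i \<Longrightarrow> rev xs \<in> saw n k i j"
    by (auto simp: saw_def simple_paths_def hd_rev last_rev)
qed auto

lemma avg_path_weight_mult:
  assumes "path_edges xs \<subseteq> all_edges n" "path_edges ys \<subseteq> all_edges n"
  shows "avg (all_edges n) (\<lambda>E. path_weight E xs * path_weight E ys) = of_bool (path_edges xs = path_edges ys)"
  unfolding path_weight_def by (rule avg_prod_spin_mult[OF finite_all_edges assms])

text \<open>By orthogonality of the characters only walks with the same edge set correlate. Both
  start at \<open>i\<close>, so they coincide; walks of different lengths never correlate.\<close>

lemma avg_saw_sum_mult:
  "avg (all_edges n) (\<lambda>E. saw_sum n a E i j * saw_sum n b E i j) = of_bool (a = b) * real (card (saw n a i j))"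
proof -
  have "avg (all_edges n) (\<lambda>E. saw_sum n a E i j * saw_sum n b E i j) =
      (\<Sum>xs\<in>saw n a i j. \<Sum>ys\<in>saw n b i j. avg (all_edges n) (\<lambda>E. path_weight E xs * path_weight E ys))"
    by (simp add: saw_sum_def sum_product avg_sum)
  also have "\<dots> = (\<Sum>xs\<in>saw n a i j. \<Sum>ys\<in>saw n b i j. of_bool (ys = xs))"
  proof (intro sum.cong refl)
    fix xs ys assume xy: "xs \<in> saw n a i j" "ys \<in> saw n b i j"
    then have "distinct xs" "distinct ys" "hd xs = hd ys" "xs \<noteq> []" "ys \<noteq> []"
      by (auto simp: saw_def simple_paths_def)
    then have "path_edges xs = path_edges ys \<longleftrightarrow> ys = xs"
      using path_edges_inj by metis
    then show "avg (all_edges n) (\<lambda>E. path_weight E xs * path_weight E ys) = of_bool (ys = xs)"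
      using xy by (simp add: avg_path_weight_mult saw_path_edges)
  qed
  also have "\<dots> = (\<Sum>xs\<in>saw n a i j. of_bool (xs \<in> saw n b i j))"
    by (simp add: of_bool_def finite_saw)
  also have "\<dots> = (\<Sum>xs\<in>saw n a i j. of_bool (a = b))"
    by (intro sum.cong refl) (auto simp: saw_def simple_paths_def)
  finally show ?thesis by simp
qed

text \<open>Double counting: the last vertex fixes \<open>j\<close>, and at most \<open>c\<close>
  vertices \<open>i\<close> satisfy \<open>Q\<close> for a given path. The predicate
  \<open>Q\<close> serves both \<open>saw\<close> and \<open>cycle_paths\<close>.\<close>

lemma sum_card_paths_le:
  assumes "\<And>xs. xs \<in> simple_paths n k \<Longrightarrow> card {i. i < n \<and> Q i xs} \<le> c"
  shows "(\<Sum>i<n. \<Sum>j<n. real (card {xs \<in> simple_paths n k. Q i xs \<and> last xs = j})) \<le> real c * real n ^ Suc k"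
proof -
  have card: "real (card {xs \<in> simple_paths n k. Q i xs \<and> last xs = j}) =
      (\<Sum>xs\<in>simple_paths n k. of_bool (Q i xs) * of_bool (last xs = j))" for i j
  proof -
    have "real (card {xs \<in> simple_paths n k. Q i xs \<and> last xs = j}) =
        (\<Sum>xs\<in>{xs \<in> simple_paths n k. Q i xs \<and> last xs = j}. 1)" by simp
    also have "\<dots> = (\<Sum>xs\<in>simple_paths n k. if Q i xs \<and> last xs = j then 1 else 0)"
      by (subst sum.inter_filter) (auto simp: finite_simple_paths)
    also have "\<dots> = (\<Sum>xs\<in>simple_paths n k. of_bool (Q i xs) * of_bool (last xs = j))"
      by (intro sum.cong) auto
    finally show ?thesis .
  qed
  have "(\<Sum>i<n. \<Sum>j<n. real (card {xs \<in> simple_paths n k. Q i xs \<and> last xs = j})) =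
      (\<Sum>i<n. \<Sum>xs\<in>simple_paths n k. \<Sum>j<n. of_bool (Q i xs) * of_bool (last xs = j))"
    unfolding card by (intro sum.cong refl sum.swap)
  also have "\<dots> = (\<Sum>xs\<in>simple_paths n k. \<Sum>i<n. \<Sum>j<n. of_bool (Q i xs) * of_bool (last xs = j))"
    by (rule sum.swap)
  also have "\<dots> \<le> (\<Sum>xs\<in>simple_paths n k. real c)"
  proof (rule sum_mono)
    fix xs assume xs: "xs \<in> simple_paths n k"
    have "(\<Sum>j<n. of_bool (last xs = j)) \<le> (1 :: real)"
      by (simp add: of_bool_def)
    then have "(\<Sum>i<n. \<Sum>j<n. of_bool (Q i xs) * of_bool (last xs = j)) \<le> (\<Sum>i<n. of_bool (Q i xs) * (1 :: real))"
      unfolding sum_distrib_left[symmetric] by (intro sum_mono mult_left_mono) auto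
    also have "\<dots> = real (card {i. i < n \<and> Q i xs})"
      by (simp add: of_bool_def sum.If_cases lessThan_def Collect_conj_eq)
    finally show "(\<Sum>i<n. \<Sum>j<n. of_bool (Q i xs) * of_bool (last xs = j)) \<le> real c"
      using assms[OF xs] by linarith
  qed
  also have "\<dots> = real c * real (card (simple_paths n k))" by simp
  also have "\<dots> \<le> real c * real (n ^ Suc k)"
    using card_simple_paths_le by (intro mult_left_mono of_nat_mono) auto
  finally show ?thesis by simp
qed

lemma sum_card_saw_le: "(\<Sum>i<n. \<Sum>j<n. real (card (saw n k i j))) \<le> real n ^ Suc k"
proof -
  have "card {i. i < n \<and> hd xs = i} \<le> 1" for xs :: "nat list"
    by (cases "hd xs < n") (auto simp: card_le_Suc0_iff_eq)
  then show ?thesis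
    using sum_card_paths_le[of n k "\<lambda>i xs. hd xs = i" 1] by (simp add: saw_def)
qed

text \<open>The vertex \<open>i\<close> closes a cycle of length at least 3 with the path; these terms make up
  the error in the three-term recurrence. A path meeting the first two conditions has at least two
  vertices, so \<open>xs ! 1\<close> is never evaluated out of range.\<close>

definition cycle_paths :: "nat \<Rightarrow> nat \<Rightarrow> nat \<Rightarrow> nat \<Rightarrow> nat list set" where
  "cycle_paths n k i j = {xs \<in> simple_paths n k. (i \<in> set xs \<and> hd xs \<noteq> i \<and> xs ! 1 \<noteq> i) \<and> last xs = j}"

definition cycle_sum :: "nat \<Rightarrow> nat \<Rightarrow> nat set set \<Rightarrow> nat \<Rightarrow> nat \<Rightarrow> real" where
  "cycle_sum n k E i j = (\<Sum>xs\<in>cycle_paths n k i j. path_weight E (i # xs))"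

lemma finite_cycle_paths: "finite (cycle_paths n k i j)"
  unfolding cycle_paths_def using finite_simple_paths by simp

lemma path_weight_Cons:
  "x \<notin> set (y # ys) \<Longrightarrow> path_weight E (x # y # ys) = spin E {x, y} * path_weight E (y # ys)"
  using path_edges_subset[of "{x, y}" "y # ys"] finite_path_edges[of "y # ys"]
  by (subst path_weight_def, subst path_edges.simps(1), subst prod.insert) (auto simp: path_weight_def)

text \<open>The only edge of the path at \<open>hd xs\<close> leads to \<open>xs ! 1\<close>, which
  differs from \<open>i\<close>. So the edge \<open>{i, hd xs}\<close> is new, and its spin is a
  genuine extra factor although \<open>path_edges\<close> is a set.\<close>

lemma path_weight_cycle:
  assumes "xs \<in> cycle_paths n k i j"
  shows "path_weight E (i # xs) = spin E {i, hd xs} * path_weight E xs"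
    and "path_edges (i # xs) \<subseteq> all_edges n"
proof -
  obtain l y zs where xs: "xs = l # y # zs"
    using assms unfolding cycle_paths_def by (cases xs rule: path_edges.cases) auto
  have *: "i \<noteq> l" "i \<noteq> y" "l \<notin> set (y # zs)" "distinct xs" "set xs \<subseteq> {..<n}" "i \<in> set xs"
    using assms by (auto simp: cycle_paths_def simple_paths_def xs)
  have "{i, l} \<notin> path_edges xs"
    using * path_edges_subset[of "{i, l}" "y # zs"] by (auto simp: xs doubleton_eq_iff)
  then show "path_weight E (i # xs) = spin E {i, hd xs} * path_weight E xs"
    using finite_path_edges[of xs] by (simp add: xs path_weight_def)
  have "i < n" "l < n" using * by (auto simp: xs)
  then show "path_edges (i # xs) \<subseteq> all_edges n"
    using * path_edges_subset_all_edges[of xs n] by (simp add: xs pair_in_all_edges)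
qed

text \<open>Sort the paths ending in \<open>j\<close> by the position of \<open>i\<close>: off the
  path (\<open>A\<close>) the walk gets one step longer; at the head (\<open>B\<close>) the zero
  diagonal kills the term; in second place (\<open>C\<close>) a step is retraced and its spin
  squares to 1; anywhere else a cycle closes.\<close>

lemma sign_mat_saw_sum:
  assumes "i < n" "j < n"
  shows "mat_prod n (sign_mat E) (saw_sum n k E) i j =
    saw_sum n (Suc k) E i j + (if k = 0 then 0 else (real n - real k) * saw_sum n (k - 1) E i j) +
    cycle_sum n k E i j"
proof -
  define P where "P = {xs \<in> simple_paths n k. last xs = j}"
  define f where "f = (\<lambda>xs. sign_mat E i (hd xs) * path_weight E xs)"
  define A where "A = {xs \<in> P. i \<notin> set xs}"
  define B where "B = {xs \<in> P. hd xs = i}"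
  \<comment> \<open>The guard \<open>k \<noteq> 0\<close> keeps \<open>xs ! 1\<close> in
    range.\<close>
  define C where "C = {xs \<in> P. k \<noteq> 0 \<and> xs ! 1 = i}"
  have finP: "finite P" unfolding P_def using finite_simple_paths by simp
  have hdlt: "hd xs < n" if "xs \<in> P" for xs
    using that by (cases xs) (auto simp: P_def simple_paths_def)
  have "mat_prod n (sign_mat E) (saw_sum n k E) i j = (\<Sum>l<n. \<Sum>xs\<in>saw n k l j. f xs)"
    unfolding mat_prod_def saw_sum_def sum_distrib_left
    by (intro sum.cong refl) (auto simp: f_def saw_def)
  also have "\<dots> = (\<Sum>l\<in>{..<n}. \<Sum>xs\<in>{xs \<in> P. hd xs = l}. f xs)"
    by (intro sum.cong refl) (auto simp: saw_def P_def)
  also have "\<dots> = (\<Sum>xs\<in>P. f xs)"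
    using finP hdlt by (intro sum.group) auto
  also have "P = A \<union> B \<union> C \<union> cycle_paths n k i j"
  proof
    show "P \<subseteq> A \<union> B \<union> C \<union> cycle_paths n k i j"
    proof
      fix xs assume xs: "xs \<in> P"
      show "xs \<in> A \<union> B \<union> C \<union> cycle_paths n k i j"
      proof (cases "k = 0")
        case True
        then show ?thesis using xs by (auto simp: A_def B_def P_def simple_paths_def length_Suc_conv)
      next
        case False
        then show ?thesis using xs by (auto simp: A_def B_def C_def P_def cycle_paths_def)
      qed
    qed
  qed (auto simp: A_def B_def C_def P_def cycle_paths_def)
  also have "sum f (A \<union> B \<union> C \<union> cycle_paths n k i j) = sum f (A \<union> B \<union> C) + sum f (cycle_paths n k i j)"
  proof (rule sum.union_disjoint)
    show "(A \<union> B \<union> C) \<inter> cycle_paths n k i j = {}"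
      by (auto simp: A_def B_def C_def cycle_paths_def)
  qed (use finP in \<open>auto simp: A_def B_def C_def finite_cycle_paths\<close>)
  also have "sum f (A \<union> B \<union> C) = sum f (A \<union> B) + sum f C"
  proof (rule sum.union_disjoint)
    have "hd xs \<noteq> i \<and> i \<in> set xs" if "xs \<in> C" for xs
      using that by (cases xs rule: path_edges.cases) (auto simp: C_def P_def simple_paths_def)
    then show "(A \<union> B) \<inter> C = {}"
      by (auto simp: A_def B_def)
  qed (use finP in \<open>auto simp: A_def B_def C_def\<close>)
  also have "sum f (A \<union> B) = sum f A + sum f B"
  proof (rule sum.union_disjoint)
    have "i \<in> set xs" if "xs \<in> B" for xs
      using that by (cases xs) (auto simp: B_def P_def simple_paths_def)
    then show "A \<inter> B = {}"
      by (auto simp: A_def)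
  qed (use finP in \<open>auto simp: A_def B_def\<close>)
  also have "sum f B = 0"
    by (intro sum.neutral) (auto simp: B_def f_def sign_mat_def)
  also have "sum f (cycle_paths n k i j) = cycle_sum n k E i j"
    unfolding cycle_sum_def
    by (intro sum.cong refl) (auto simp: f_def sign_mat_def path_weight_cycle(1), auto simp: cycle_paths_def)
  also have "sum f A = saw_sum n (Suc k) E i j"
    unfolding saw_sum_def
  proof (rule sum.reindex_bij_witness[where i = tl and j = "(#) i"])
    fix xs assume xs: "xs \<in> A"
    then obtain y ys where ys: "xs = y # ys" by (cases xs) (auto simp: A_def P_def simple_paths_def)
    show "tl (i # xs) = xs" by simp
    show "i # xs \<in> saw n (Suc k) i j"
      using xs assms ys by (auto simp: A_def P_def simple_paths_def saw_def)
    show "path_weight E (i # xs) = f xs"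
      using xs path_weight_Cons[of i y ys E] by (auto simp: ys A_def f_def sign_mat_def)
  next
    fix xs assume xs: "xs \<in> saw n (Suc k) i j"
    then obtain y ys where ys: "xs = i # y # ys"
      by (cases xs rule: path_edges.cases) (auto simp: saw_def simple_paths_def)
    show "i # tl xs = xs" "tl xs \<in> A"
      using xs by (auto simp: ys A_def P_def saw_def simple_paths_def)
  qed
  also have "sum f C = (if k = 0 then 0 else (real n - real k) * saw_sum n (k - 1) E i j)"
  proof (cases k)
    case 0
    then show ?thesis by (simp add: C_def)
  next
    case (Suc m)
    \<comment> \<open>Deleting the head \<open>l\<close> leaves a walk from \<open>i\<close> with
      \<open>k\<close> vertices, and \<open>l\<close> is any of the other \<open>n - k\<close>
      vertices.\<close>
    have "sum f C = (\<Sum>(ys, l)\<in>(SIGMA ys:saw n m i j. {..<n} - set ys). path_weight E ys)"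
    proof (rule sum.reindex_bij_witness[where j = "\<lambda>xs. (tl xs, hd xs)" and i = "\<lambda>(ys, l). l # ys"])
      fix xs assume xs: "xs \<in> C"
      then obtain l zs where zs: "xs = l # i # zs"
        by (cases xs rule: path_edges.cases) (auto simp: C_def P_def simple_paths_def)
      show "(case (tl xs, hd xs) of (ys, l) \<Rightarrow> l # ys) = xs" by (simp add: zs)
      show "(tl xs, hd xs) \<in> (SIGMA ys:saw n m i j. {..<n} - set ys)"
        using xs by (auto simp: zs C_def P_def simple_paths_def saw_def Suc)
      have "l \<notin> set (i # zs)" using xs by (auto simp: zs C_def P_def simple_paths_def)
      then have "f xs = spin E {i, l} * spin E {i, l} * path_weight E (i # zs)"
        using path_weight_Cons[of l i zs E] by (auto simp: zs f_def sign_mat_def insert_commute)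
      then show "(case (tl xs, hd xs) of (ys, l) \<Rightarrow> path_weight E ys) = f xs" by (simp add: zs)
    next
      fix p assume p: "p \<in> (SIGMA ys:saw n m i j. {..<n} - set ys)"
      then obtain ys l where yl: "p = (ys, l)" "ys \<in> saw n m i j" "l < n" "l \<notin> set ys" by auto
      show "(tl (case p of (ys, l) \<Rightarrow> l # ys), hd (case p of (ys, l) \<Rightarrow> l # ys)) = p" by (simp add: yl)
      show "(case p of (ys, l) \<Rightarrow> l # ys) \<in> C"
        using yl(2-4) by (cases ys) (auto simp: yl(1) C_def P_def simple_paths_def saw_def Suc)
    qed
    also have "\<dots> = (\<Sum>ys\<in>saw n m i j. \<Sum>l\<in>{..<n} - set ys. path_weight E ys)"
      by (rule sum.Sigma[symmetric]) (auto simp: finite_saw)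
    also have "\<dots> = (\<Sum>ys\<in>saw n m i j. (real n - real k) * path_weight E ys)"
    proof (intro sum.cong refl)
      fix ys assume "ys \<in> saw n m i j"
      then have ys: "set ys \<subseteq> {..<n}" "card (set ys) = k"
        by (auto simp: saw_def simple_paths_def Suc distinct_card)
      \<comment> \<open>A walk exists here, so \<open>k \<le> n\<close> and the natural subtraction
        is exact.\<close>
      then have "k \<le> n" by (metis card_lessThan card_mono finite_lessThan)
      then have "real (card ({..<n} - set ys)) = real n - real k"
        using ys by (simp add: card_Diff_subset of_nat_diff)
      then show "(\<Sum>l\<in>{..<n} - set ys. path_weight E ys) = (real n - real k) * path_weight E ys" by simp
    qed
    finally show ?thesis by (simp add: Suc saw_sum_def sum_distrib_left)
  qed
  finally show ?thesis by simp
qed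

text \<open>Two terms correlate only if their edge sets agree, hence also their vertex sets, which
  leaves at most \<open>Suc k ^ Suc k\<close> partners for \<open>xs\<close>. As \<open>i\<close>
  lies on \<open>xs\<close>, it has at most \<open>Suc k\<close> values instead of \<open>n\<close>;
  this saved factor \<open>n\<close> makes the error small.\<close>

lemma avg_frob_sq_cycle_sum_le:
  "avg (all_edges n) (\<lambda>E. frob_sq n (cycle_sum n k E)) \<le> real (Suc k) * real (Suc k) ^ Suc k * real n ^ Suc k"
proof -
  have entry: "avg (all_edges n) (\<lambda>E. (cycle_sum n k E i j)\<^sup>2) \<le>
      real (Suc k ^ Suc k) * real (card (cycle_paths n k i j))" for i j
  proof -
    have "avg (all_edges n) (\<lambda>E. (cycle_sum n k E i j)\<^sup>2) =
        (\<Sum>xs\<in>cycle_paths n k i j. \<Sum>ys\<in>cycle_paths n k i j.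
          avg (all_edges n) (\<lambda>E. path_weight E (i # xs) * path_weight E (i # ys)))"
      by (simp add: cycle_sum_def power2_eq_square sum_product avg_sum)
    also have "\<dots> \<le> (\<Sum>xs\<in>cycle_paths n k i j. real (Suc k ^ Suc k))"
    proof (rule sum_mono)
      fix xs assume xs: "xs \<in> cycle_paths n k i j"
      let ?L = "{ys. set ys \<subseteq> set xs \<and> length ys = Suc k}"
      have "(\<Sum>ys\<in>cycle_paths n k i j. avg (all_edges n) (\<lambda>E. path_weight E (i # xs) * path_weight E (i # ys)))
          \<le> (\<Sum>ys\<in>cycle_paths n k i j. of_bool (ys \<in> ?L))"
      proof (rule sum_mono)
        fix ys assume ys: "ys \<in> cycle_paths n k i j"
        \<comment> \<open>Since \<open>i\<close> already lies on \<open>zs\<close>, prepending it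
          adds no vertex.\<close>
        have *: "\<Union>(path_edges (i # zs)) = set zs" if "zs \<in> cycle_paths n k i j" for zs
          using that by (subst Union_path_edges) (auto simp: cycle_paths_def simple_paths_def)
        have "ys \<in> ?L" if "path_edges (i # xs) = path_edges (i # ys)"
          using *[OF xs] *[OF ys] that ys by (simp add: cycle_paths_def simple_paths_def)
        then show "avg (all_edges n) (\<lambda>E. path_weight E (i # xs) * path_weight E (i # ys)) \<le> of_bool (ys \<in> ?L)"
          using avg_path_weight_mult[OF path_weight_cycle(2)[OF xs] path_weight_cycle(2)[OF ys]] by auto
      qed
      also have "\<dots> = real (card (cycle_paths n k i j \<inter> ?L))"
        by (simp add: of_bool_def sum.If_cases finite_cycle_paths)
      also have "\<dots> \<le> real (card ?L)"
        by (intro of_nat_mono card_mono) (auto simp: finite_lists_length_eq)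
      also have "card ?L = Suc k ^ Suc k"
        using xs by (subst card_lists_length_eq) (auto simp: cycle_paths_def simple_paths_def distinct_card)
      finally show "(\<Sum>ys\<in>cycle_paths n k i j. avg (all_edges n) (\<lambda>E. path_weight E (i # xs) * path_weight E (i # ys)))
          \<le> real (Suc k ^ Suc k)" .
    qed
    finally show ?thesis by (simp add: mult.commute)
  qed
  have "avg (all_edges n) (\<lambda>E. frob_sq n (cycle_sum n k E)) =
      (\<Sum>i<n. \<Sum>j<n. avg (all_edges n) (\<lambda>E. (cycle_sum n k E i j)\<^sup>2))"
    by (simp add: frob_sq_def avg_sum)
  also have "\<dots> \<le> (\<Sum>i<n. \<Sum>j<n. real (Suc k ^ Suc k) * real (card (cycle_paths n k i j)))"
    by (intro sum_mono entry)
  also have "\<dots> = real (Suc k ^ Suc k) * (\<Sum>i<n. \<Sum>j<n. real (card (cycle_paths n k i j)))"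
    by (simp only: sum_distrib_left)
  also have "\<dots> \<le> real (Suc k ^ Suc k) * (real (Suc k) * real n ^ Suc k)"
    unfolding cycle_paths_def
  proof (intro mult_left_mono sum_card_paths_le)
    fix xs assume "xs \<in> simple_paths n k"
    then have "card (set xs) = Suc k" by (simp add: simple_paths_def distinct_card)
    then show "card {i. i < n \<and> i \<in> set xs \<and> hd xs \<noteq> i \<and> xs ! 1 \<noteq> i} \<le> Suc k"
      using card_mono[of "set xs" "{i. i < n \<and> i \<in> set xs \<and> hd xs \<noteq> i \<and> xs ! 1 \<noteq> i}"] by auto
  qed auto
  finally show ?thesis by (simp only: of_nat_power mult_ac)
qed

section \<open>Chebyshev polynomials and the semicircle law\<close>

text \<open>The Chebyshev polynomials of the second kind at \<open>x / 2\<close>, so that their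
  interval is the support \<open>[-2, 2]\<close> of the semicircle law.\<close>

fun cheb :: "nat \<Rightarrow> real \<Rightarrow> real" where
  "cheb 0 x = 1"
| "cheb (Suc 0) x = x"
| "cheb (Suc (Suc k)) x = x * cheb (Suc k) x - cheb k x"

text \<open>Both sides satisfy the same recurrence, by
  \<open>sin (A + t) + sin (A - t) = 2 * cos t * sin A\<close>.\<close>

lemma cheb_cos: "cheb k (2 * cos t) * sin t = sin (real (Suc k) * t)"
proof (induction k "2 * cos t" rule: cheb.induct)
  case 2
  then show ?case by (simp add: sin_double)
next
  case (3 k)
  define A where "A = real (Suc (Suc k)) * t"
  have "cheb (Suc (Suc k)) (2 * cos t) * sin t = 2 * cos t * sin A - sin (A - t)"
    using 3 by (simp add: A_def algebra_simps)
  also have "\<dots> = sin (A + t)"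
    by (simp add: sin_add sin_diff)
  also have "A + t = real (Suc (Suc (Suc k))) * t"
    by (simp add: A_def algebra_simps)
  finally show ?case .
qed simp

lemma has_integral_cos_int:
  "((\<lambda>t. cos (real_of_int m * t)) has_integral (if m = 0 then pi else 0)) {0..pi}"
proof (cases "m = 0")
  case True
  then show ?thesis using has_integral_const_real[of "1 :: real" 0 pi] by simp
next
  case False
  have "((\<lambda>t. cos (real_of_int m * t)) has_integral
      (sin (real_of_int m * pi) / real_of_int m - sin (real_of_int m * 0) / real_of_int m)) {0..pi}"
    using False
    by (intro fundamental_theorem_of_calculus)
      (auto intro!: derivative_eq_intros simp flip: has_real_derivative_iff_has_vector_derivative)
  moreover have "sin (real_of_int m * pi) = 0"
    by (simp add: sin_zero_iff_int2)
  ultimately show ?thesis using False by simp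
qed

lemma has_integral_sin_sin:
  "((\<lambda>t. sin (real (Suc a) * t) * sin (real (Suc b) * t)) has_integral of_bool (a = b) * (pi / 2)) {0..pi}"
proof -
  let ?d = "int a - int b" and ?s = "int a + int b + 2"
  have "((\<lambda>t. (cos (real_of_int ?d * t) - cos (real_of_int ?s * t)) / 2) has_integral
      ((if ?d = 0 then pi else 0) - (if ?s = 0 then pi else 0)) / 2) {0..pi}"
    by (intro has_integral_divide has_integral_diff has_integral_cos_int)
  moreover have "(cos (real_of_int ?d * t) - cos (real_of_int ?s * t)) / 2 =
      sin (real (Suc a) * t) * sin (real (Suc b) * t)" for t
  proof -
    have "real_of_int ?d * t = real (Suc a) * t - real (Suc b) * t"
      "real_of_int ?s * t = real (Suc a) * t + real (Suc b) * t"
      by (simp_all add: algebra_simps)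
    then show ?thesis by (simp only: sin_times_sin)
  qed
  ultimately show ?thesis by (simp split: if_splits)
qed

text \<open>Under \<open>x = 2 * cos t\<close> the semicircle law has density
  \<open>(2 / pi) * (sin t)\<^sup>2\<close> on \<open>[0, pi]\<close>. This is Parseval's identity
  for that law, multiplied by \<open>pi / 2\<close>; the law itself is never introduced as a
  measure.\<close>

lemma parseval_cheb:
  "((\<lambda>t. (\<Sum>k\<le>N. c k * cheb k (2 * cos t))\<^sup>2 * (sin t)\<^sup>2) has_integral (\<Sum>k\<le>N. (c k)\<^sup>2) * (pi / 2)) {0..pi}"
proof -
  have "((\<lambda>t. \<Sum>a\<le>N. \<Sum>b\<le>N. c a * c b * (sin (real (Suc a) * t) * sin (real (Suc b) * t))) has_integral
      (\<Sum>a\<le>N. \<Sum>b\<le>N. c a * c b * (of_bool (a = b) * (pi / 2)))) {0..pi}"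
    by (intro has_integral_sum has_integral_mult_right has_integral_sin_sin) auto
  moreover have "(\<Sum>a\<le>N. \<Sum>b\<le>N. c a * c b * (of_bool (a = b) * (pi / 2))) = (\<Sum>k\<le>N. (c k)\<^sup>2) * (pi / 2)"
    unfolding sum_distrib_right
  proof (intro sum.cong refl)
    fix a assume "a \<in> {..N}"
    then have "(\<Sum>b\<le>N. if a = b then c a * c b * (pi / 2) else 0) = (c a)\<^sup>2 * (pi / 2)"
      by (simp add: power2_eq_square)
    moreover have "c a * c b * (of_bool (a = b) * (pi / 2)) = (if a = b then c a * c b * (pi / 2) else 0)" for b
      by simp
    ultimately show "(\<Sum>b\<le>N. c a * c b * (of_bool (a = b) * (pi / 2))) = (c a)\<^sup>2 * (pi / 2)"
      by presburger
  qed
  moreover have "(\<Sum>a\<le>N. \<Sum>b\<le>N. c a * c b * (sin (real (Suc a) * t) * sin (real (Suc b) * t))) =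
      (\<Sum>k\<le>N. c k * cheb k (2 * cos t))\<^sup>2 * (sin t)\<^sup>2" for t
  proof -
    have "(\<Sum>k\<le>N. c k * cheb k (2 * cos t))\<^sup>2 * (sin t)\<^sup>2 = (\<Sum>k\<le>N. c k * (cheb k (2 * cos t) * sin t))\<^sup>2"
      by (simp add: power_mult_distrib[symmetric] sum_distrib_right mult.assoc)
    also have "\<dots> = (\<Sum>k\<le>N. c k * sin (real (Suc k) * t))\<^sup>2"
      by (simp only: cheb_cos)
    also have "\<dots> = (\<Sum>a\<le>N. \<Sum>b\<le>N. c a * c b * (sin (real (Suc a) * t) * sin (real (Suc b) * t)))"
      unfolding power2_eq_square sum_product by (simp only: mult_ac)
    finally show ?thesis by simp
  qed
  ultimately show ?thesis by (simp only:)
qed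

text \<open>Multiplied by \<open>2 / pi\<close> this is the semicircle mean
  \<open>8 / (3 * pi)\<close> of the absolute value, the source of the final constant.\<close>

lemma has_integral_abs_cos_sin_sq:
  "((\<lambda>t. \<bar>2 * cos t\<bar> * (sin t)\<^sup>2) has_integral 4 / 3) {0..pi}"
proof -
  have d: "((\<lambda>t. c * (2 / 3 * sin t ^ 3)) has_vector_derivative c * (2 * cos t) * (sin t)\<^sup>2) (at t within S)" for c t S
    by (auto intro!: derivative_eq_intros simp flip: has_real_derivative_iff_has_vector_derivative)
  have "((\<lambda>t. 1 * (2 * cos t) * (sin t)\<^sup>2) has_integral
      (1 * (2 / 3 * sin (pi / 2) ^ 3) - 1 * (2 / 3 * sin 0 ^ 3))) {0..pi / 2}"
    by (intro fundamental_theorem_of_calculus d) auto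
  then have "((\<lambda>t. \<bar>2 * cos t\<bar> * (sin t)\<^sup>2) has_integral 2 / 3) {0..pi / 2}"
    by (rule has_integral_eq_rhs[OF has_integral_eq[rotated]]) (auto simp: cos_ge_zero)
  moreover have "((\<lambda>t. -1 * (2 * cos t) * (sin t)\<^sup>2) has_integral
      (-1 * (2 / 3 * sin pi ^ 3) - -1 * (2 / 3 * sin (pi / 2) ^ 3))) {pi / 2..pi}"
    by (intro fundamental_theorem_of_calculus d) auto
  then have "((\<lambda>t. \<bar>2 * cos t\<bar> * (sin t)\<^sup>2) has_integral 2 / 3) {pi / 2..pi}"
  proof (rule has_integral_eq_rhs[OF has_integral_eq[rotated]])
    fix t assume "t \<in> {pi / 2..pi}"
    then have "cos t \<le> 0" using cos_ge_zero[of "pi - t"] by simp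
    then show "- 1 * (2 * cos t) * (sin t)\<^sup>2 = \<bar>2 * cos t\<bar> * (sin t)\<^sup>2" by simp
  qed simp
  ultimately show ?thesis
    using has_integral_combine[of 0 "pi / 2" pi "\<lambda>t. \<bar>2 * cos t\<bar> * (sin t)\<^sup>2" "2 / 3" "2 / 3"] by simp
qed

text \<open>Parseval turns the sum of squares into the semicircle mean of \<open>f\<^sup>2\<close>;
  the pointwise bound is then integrated over \<open>[-2, 2]\<close>.\<close>

lemma sum_coeffs_le:
  assumes f: "\<And>x. f x = (\<Sum>k\<le>N. c k * cheb k x)"
    and le: "\<And>x. \<bar>x\<bar> \<le> 2 \<Longrightarrow> (f x)\<^sup>2 \<le> a * \<bar>x\<bar> + b"
  shows "(\<Sum>k\<le>N. (c k)\<^sup>2) \<le> a * (8 / (3 * pi)) + b"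
proof -
  have "((\<lambda>t. (sin t)\<^sup>2) has_integral pi / 2) {0..pi}"
    using has_integral_sin_sin[of 0 0] by (simp add: power2_eq_square)
  then have "((\<lambda>t. a * (\<bar>2 * cos t\<bar> * (sin t)\<^sup>2) + b * (sin t)\<^sup>2) has_integral a * (4 / 3) + b * (pi / 2)) {0..pi}"
    by (intro has_integral_add has_integral_mult_right has_integral_abs_cos_sin_sq)
  then have "(\<Sum>k\<le>N. (c k)\<^sup>2) * (pi / 2) \<le> a * (4 / 3) + b * (pi / 2)"
  proof (rule has_integral_le[OF parseval_cheb])
    fix t :: real
    have "(f (2 * cos t))\<^sup>2 * (sin t)\<^sup>2 \<le> (a * \<bar>2 * cos t\<bar> + b) * (sin t)\<^sup>2"
      using le[of "2 * cos t"] by (intro mult_right_mono) (auto simp: abs_mult)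
    then show "(\<Sum>k\<le>N. c k * cheb k (2 * cos t))\<^sup>2 * (sin t)\<^sup>2 \<le> a * (\<bar>2 * cos t\<bar> * (sin t)\<^sup>2) + b * (sin t)\<^sup>2"
      by (simp add: f algebra_simps)
  qed
  then show ?thesis by (simp add: field_simps)
qed

section \<open>Expansion of polynomials in the Chebyshev basis\<close>

definition cheb_expandable :: "(real \<Rightarrow> real) \<Rightarrow> bool" where
  "cheb_expandable f \<longleftrightarrow> (\<exists>N0 c. \<forall>N\<ge>N0. \<forall>x. f x = (\<Sum>k\<le>N. c k * cheb k x))"

lemma cheb_expandable_cheb: "cheb_expandable (cheb a)"
  unfolding cheb_expandable_def
  by (intro exI[of _ a] exI[of _ "\<lambda>k. of_bool (k = a)"]) (auto simp: of_bool_def if_distrib[of "\<lambda>x. x * _"] cong: if_cong)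

lemma cheb_expandable_add:
  assumes "cheb_expandable f" "cheb_expandable g"
  shows "cheb_expandable (\<lambda>x. f x + g x)"
proof -
  obtain N1 c where f: "\<And>N x. N \<ge> N1 \<Longrightarrow> f x = (\<Sum>k\<le>N. c k * cheb k x)"
    using assms(1) unfolding cheb_expandable_def by blast
  obtain N2 d where g: "\<And>N x. N \<ge> N2 \<Longrightarrow> g x = (\<Sum>k\<le>N. d k * cheb k x)"
    using assms(2) unfolding cheb_expandable_def by blast
  have "f x + g x = (\<Sum>k\<le>N. (c k + d k) * cheb k x)" if "N \<ge> max N1 N2" for N x
    using f[of N x] g[of N x] that by (simp add: distrib_right sum.distrib)
  then show ?thesis
    unfolding cheb_expandable_def by (intro exI[of _ "max N1 N2"] exI[of _ "\<lambda>k. c k + d k"]) blast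
qed

lemma cheb_expandable_scale:
  assumes "cheb_expandable f"
  shows "cheb_expandable (\<lambda>x. a * f x)"
proof -
  obtain N1 c where "\<forall>N\<ge>N1. \<forall>x. f x = (\<Sum>k\<le>N. c k * cheb k x)"
    using assms(1) unfolding cheb_expandable_def by blast
  then have "\<forall>N\<ge>N1. \<forall>x. a * f x = (\<Sum>k\<le>N. (a * c k) * cheb k x)"
    by (simp add: sum_distrib_left mult.assoc)
  then show ?thesis
    unfolding cheb_expandable_def by (intro exI[of _ N1] exI[of _ "\<lambda>k. a * c k"])
qed

lemma cheb_expandable_sum:
  fixes n :: nat
  assumes "\<And>k. k \<le> n \<Longrightarrow> cheb_expandable (f k)"
  shows "cheb_expandable (\<lambda>x. \<Sum>k\<le>n. f k x)"
  using assms by (induction n) (auto intro: cheb_expandable_add)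

lemma cheb_expandable_mult_x:
  assumes "cheb_expandable f"
  shows "cheb_expandable (\<lambda>x. x * f x)"
proof -
  obtain N c where f: "\<And>x. f x = (\<Sum>k\<le>N. c k * cheb k x)"
    using assms(1) unfolding cheb_expandable_def by blast
  have "cheb_expandable (\<lambda>x. x * cheb k x)" for k
  proof (cases k)
    case 0
    moreover have "cheb 1 = (\<lambda>x. x)" by auto
    ultimately show ?thesis using cheb_expandable_cheb[of 1] by simp
  next
    case (Suc m)
    then show ?thesis
      using cheb_expandable_add[OF cheb_expandable_cheb[of "Suc k"] cheb_expandable_cheb[of m]] by simp
  qed
  then have "cheb_expandable (\<lambda>x. \<Sum>k\<le>N. c k * (x * cheb k x))"
    by (intro cheb_expandable_sum cheb_expandable_scale)
  then show ?thesis by (simp add: f sum_distrib_left mult_ac)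
qed

lemma cheb_expandable_polynomial:
  assumes "real_polynomial_function f"
  shows "cheb_expandable f"
proof -
  obtain a n where f: "f = (\<lambda>x. \<Sum>i\<le>n. a i * x ^ i)"
    using assms real_polynomial_function_iff_sum[of f] by blast
  have "cheb_expandable (\<lambda>x. x ^ i)" for i
  proof (induction i)
    case 0
    have "cheb 0 = (\<lambda>x. 1)" by auto
    then show ?case using cheb_expandable_cheb[of 0] by simp
  next
    case (Suc i)
    then show ?case using cheb_expandable_mult_x by simp
  qed
  then show ?thesis
    unfolding f by (intro cheb_expandable_sum cheb_expandable_scale)
qed

text \<open>Weierstrass approximation followed by a change to the Chebyshev basis. Only
  \<open>\<bar>g x\<bar>\<close> is prescribed, so both the even and the odd square root
  qualify.\<close>

lemma approx_sqrt_cheb: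
  fixes g :: "real \<Rightarrow> real"
  assumes "continuous_on {-2..2} g" "\<And>x. \<bar>g x\<bar> = sqrt \<bar>x\<bar>" "0 < d" "d \<le> 1"
  obtains f N c where "\<And>x. f x = (\<Sum>k\<le>N. c k * cheb k x)" "\<And>x. \<bar>x\<bar> \<le> 2 \<Longrightarrow> \<bar>f x - g x\<bar> < d"
    "(\<Sum>k\<le>N. (c k)\<^sup>2) \<le> 8 / (3 * pi) + 4 * d"
proof -
  obtain f where poly: "real_polynomial_function f" and close: "\<And>x. x \<in> {-2..2} \<Longrightarrow> \<bar>g x - f x\<bar> < d"
    using Stone_Weierstrass_real_polynomial_function[OF _ assms(1,3)] by (metis compact_Icc)
  obtain N c where f: "\<And>x. f x = (\<Sum>k\<le>N. c k * cheb k x)"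
    using cheb_expandable_polynomial[OF poly] unfolding cheb_expandable_def by blast
  have close': "\<bar>f x - g x\<bar> < d" if "\<bar>x\<bar> \<le> 2" for x
    using close[of x] that by (auto simp: abs_le_iff abs_minus_commute)
  have "(f x)\<^sup>2 \<le> 1 * \<bar>x\<bar> + 4 * d" if x: "\<bar>x\<bar> \<le> 2" for x
  proof -
    have "\<bar>f x\<bar> \<le> sqrt \<bar>x\<bar> + d" using close'[OF x] assms(2)[of x] by linarith
    then have "(f x)\<^sup>2 \<le> (sqrt \<bar>x\<bar> + d)\<^sup>2" by (metis abs_ge_zero power2_abs power_mono)
    also have "\<dots> = \<bar>x\<bar> + d * (2 * sqrt \<bar>x\<bar> + d)" by (simp add: power2_eq_square algebra_simps)
    \<comment> \<open>With this bound and \<open>d \<le> 1\<close> the factor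
      \<open>2 * sqrt \<bar>x\<bar> + d\<close> is at most 4, whence the term
      \<open>4 * d\<close>.\<close>
    also have "sqrt \<bar>x\<bar> \<le> 3 / 2"
      using x by (intro real_le_lsqrt) (auto simp: power2_eq_square)
    finally have "(f x)\<^sup>2 \<le> \<bar>x\<bar> + d * (3 + d)" using assms(3) by (simp add: mult_left_mono)
    moreover have "d * (3 + d) \<le> d * 4" using assms(3,4) by (intro mult_left_mono) auto
    ultimately show ?thesis by simp
  qed
  from that[OF f close' sum_coeffs_le[OF f this, simplified]] show ?thesis .
qed

section \<open>Approximate Chebyshev recurrence\<close>

definition saw_mat :: "nat \<Rightarrow> nat \<Rightarrow> nat set set \<Rightarrow> nat \<Rightarrow> nat \<Rightarrow> real" where
  "saw_mat n k E i j = saw_sum n k E i j / sqrt (real n) ^ k"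

lemma sqrt_power_sq: "(sqrt (real n) ^ k)\<^sup>2 = real n ^ k"
  by (metis of_nat_0_le_iff power_commutes power_mult real_sqrt_pow2 mult.commute)

lemma saw_mat_symmetric: "saw_mat n k E i j = saw_mat n k E j i"
  unfolding saw_mat_def by (subst saw_sum_symmetric) simp

text \<open>Orthogonality in mean removes the cross terms; at most \<open>n ^ Suc k\<close> walks,
  divided by \<open>n ^ k\<close>, leave a factor \<open>n\<close> for every
  \<open>k\<close>.\<close>

lemma avg_frob_sq_saw_comb_le:
  assumes "n \<ge> 1"
  shows "avg (all_edges n) (\<lambda>E. frob_sq n (\<lambda>i j. \<Sum>k\<le>N. c k * saw_mat n k E i j)) \<le> real n * (\<Sum>k\<le>N. (c k)\<^sup>2)"
proof -
  have entry: "avg (all_edges n) (\<lambda>E. (\<Sum>k\<le>N. c k * saw_mat n k E i j)\<^sup>2) =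
      (\<Sum>k\<le>N. (c k)\<^sup>2 / real n ^ k * real (card (saw n k i j)))" for i j
  proof -
    define d where "d = (\<lambda>k. c k / sqrt (real n) ^ k)"
    have "(\<Sum>k\<le>N. c k * saw_mat n k E i j)\<^sup>2 =
        (\<Sum>a\<le>N. \<Sum>b\<le>N. d a * d b * (saw_sum n a E i j * saw_sum n b E i j))" for E
      unfolding power2_eq_square sum_product saw_mat_def d_def by (intro sum.cong refl) simp
    then have "avg (all_edges n) (\<lambda>E. (\<Sum>k\<le>N. c k * saw_mat n k E i j)\<^sup>2) =
        (\<Sum>a\<le>N. \<Sum>b\<le>N. d a * d b * (of_bool (a = b) * real (card (saw n a i j))))"
      by (simp only: avg_sum avg_cmult avg_saw_sum_mult)
    also have "\<dots> = (\<Sum>a\<le>N. \<Sum>b\<le>N. if a = b then d a * d b * real (card (saw n a i j)) else 0)"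
      by (intro sum.cong refl) simp
    also have "\<dots> = (\<Sum>a\<le>N. (d a)\<^sup>2 * real (card (saw n a i j)))"
      by (intro sum.cong refl) (simp add: power2_eq_square)
    finally show ?thesis by (simp add: d_def power_divide sqrt_power_sq)
  qed
  have "avg (all_edges n) (\<lambda>E. frob_sq n (\<lambda>i j. \<Sum>k\<le>N. c k * saw_mat n k E i j)) =
      (\<Sum>i<n. \<Sum>j<n. \<Sum>k\<le>N. (c k)\<^sup>2 / real n ^ k * real (card (saw n k i j)))"
    by (simp only: frob_sq_def avg_sum entry)
  also have "\<dots> = (\<Sum>i<n. \<Sum>k\<le>N. \<Sum>j<n. (c k)\<^sup>2 / real n ^ k * real (card (saw n k i j)))"
    by (intro sum.cong refl sum.swap)
  also have "\<dots> = (\<Sum>k\<le>N. \<Sum>i<n. \<Sum>j<n. (c k)\<^sup>2 / real n ^ k * real (card (saw n k i j)))"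
    by (rule sum.swap)
  also have "\<dots> = (\<Sum>k\<le>N. (c k)\<^sup>2 / real n ^ k * (\<Sum>i<n. \<Sum>j<n. real (card (saw n k i j))))"
    by (simp only: sum_distrib_left)
  also have "\<dots> \<le> (\<Sum>k\<le>N. (c k)\<^sup>2 / real n ^ k * real n ^ Suc k)"
    by (intro sum_mono mult_left_mono sum_card_saw_le) auto
  also have "\<dots> = real n * (\<Sum>k\<le>N. (c k)\<^sup>2)"
    unfolding sum_distrib_left using assms by (intro sum.cong refl) simp
  finally show ?thesis .
qed

lemma avg_frob_sq_saw_mat_le:
  assumes "n \<ge> 1"
  shows "avg (all_edges n) (\<lambda>E. frob_sq n (saw_mat n k E)) \<le> real n"
proof -
  have "(\<Sum>l\<le>k. of_bool (l = k) * saw_mat n l E i j) = saw_mat n k E i j" for E i j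
    by (simp add: of_bool_def if_distrib[of "\<lambda>x. x * _"] cong: if_cong)
  moreover have "(\<Sum>l\<le>k. (of_bool (l = k) :: real)\<^sup>2) = 1"
    by (simp add: of_bool_def if_distrib[of "\<lambda>x. x\<^sup>2"] cong: if_cong)
  ultimately show ?thesis
    using avg_frob_sq_saw_comb_le[OF assms, of "\<lambda>l. of_bool (l = k)" k] by simp
qed

definition norm_mat :: "nat \<Rightarrow> nat set set \<Rightarrow> nat \<Rightarrow> nat \<Rightarrow> real" where
  "norm_mat n E i j = sign_mat E i j / sqrt (real n)"

lemma saw_mat_0: "i < n \<Longrightarrow> j < n \<Longrightarrow> saw_mat n 0 E i j = id_mat i j"
  by (simp add: saw_mat_def saw_sum_0)

lemma saw_mat_1: "i < n \<Longrightarrow> j < n \<Longrightarrow> saw_mat n (Suc 0) E i j = norm_mat n E i j"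
  using saw_sum_1[of i n j E] by (simp add: saw_mat_def norm_mat_def)

text \<open>The convention \<open>T\<^sub>-\<^sub>1 = 0\<close> makes the recurrence uniform in
  \<open>k\<close>.\<close>

definition saw_mat_pred :: "nat \<Rightarrow> nat \<Rightarrow> nat set set \<Rightarrow> nat \<Rightarrow> nat \<Rightarrow> real" where
  "saw_mat_pred n k E i j = (if k = 0 then 0 else saw_mat n (k - 1) E i j)"

definition rec_err :: "nat \<Rightarrow> nat \<Rightarrow> nat set set \<Rightarrow> nat \<Rightarrow> nat \<Rightarrow> real" where
  "rec_err n k E i j = mat_prod n (norm_mat n E) (saw_mat n k E) i j - saw_mat n (Suc k) E i j - saw_mat_pred n k E i j"

text \<open>The error has two sources, the cycle terms and the deficit \<open>- k\<close> in the
  factor \<open>n - k\<close> of \<open>sign_mat_saw_sum\<close>. After division by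
  \<open>n ^ Suc k\<close> both squared Frobenius norms have means bounded in terms of
  \<open>k\<close> alone.\<close>

lemma avg_frob_sq_rec_err_le:
  "\<exists>K. \<forall>n\<ge>1. avg (all_edges n) (\<lambda>E. frob_sq n (rec_err n k E)) \<le> K"
proof (intro exI allI impI)
  fix n :: nat assume n: "n \<ge> 1"
  let ?C = "real (Suc k) * real (Suc k) ^ Suc k"
  let ?s = "sqrt (real n) ^ Suc k"
  have s: "?s > 0" "?s\<^sup>2 = real n ^ Suc k" "sqrt (real n) > 0" "sqrt (real n) * sqrt (real n) = real n"
    using n by (auto simp: sqrt_power_sq simp del: power_Suc)
  have err: "rec_err n k E i j = 1 / ?s * (cycle_sum n k E i j - real k * saw_sum n (k - 1) E i j)"
    if "i < n" "j < n" for E i j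
  proof -
    have "mat_prod n (norm_mat n E) (saw_mat n k E) i j = 1 / ?s * mat_prod n (sign_mat E) (saw_sum n k E) i j"
      by (simp add: mat_prod_def norm_mat_def saw_mat_def sum_divide_distrib)
    moreover have "saw_mat_pred n k E i j = 1 / ?s * (if k = 0 then 0 else real n * saw_sum n (k - 1) E i j)"
    proof (cases k)
      case (Suc m)
      have "1 / ?s * real n = 1 / sqrt (real n) ^ m"
        using s by (simp add: Suc field_simps)
      then have "saw_mat_pred n k E i j = 1 / ?s * real n * saw_sum n m E i j"
        by (simp only: saw_mat_pred_def saw_mat_def Suc) simp
      then show ?thesis by (simp add: Suc)
    qed (simp add: saw_mat_pred_def)
    ultimately show ?thesis
      unfolding rec_err_def saw_mat_def sign_mat_saw_sum[OF that]
      by (cases "k = 0") (simp_all add: algebra_simps diff_divide_distrib add_divide_distrib)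
  qed
  have "avg (all_edges n) (\<lambda>E. frob_sq n (rec_err n k E)) \<le>
      avg (all_edges n) (\<lambda>E. 1 / real n ^ Suc k * (2 * (frob_sq n (cycle_sum n k E) + (real k)\<^sup>2 * (real n ^ (k - 1) * frob_sq n (saw_mat n (k - 1) E)))))"
  proof (rule avg_mono)
    fix E
    have "frob_sq n (rec_err n k E) = (1 / ?s)\<^sup>2 * frob_sq n (\<lambda>i j. cycle_sum n k E i j - real k * saw_sum n (k - 1) E i j)"
      by (simp only: frob_sq_scale[symmetric] err cong: frob_sq_cong)
    also have "\<dots> \<le> (1 / ?s)\<^sup>2 * (2 * (frob_sq n (cycle_sum n k E) + frob_sq n (\<lambda>i j. real k * saw_sum n (k - 1) E i j)))"
      by (intro mult_left_mono frob_sq_diff_le) simp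
    also have "(1 / ?s)\<^sup>2 = 1 / real n ^ Suc k"
      by (simp only: power_divide s(2)) simp
    also have "frob_sq n (\<lambda>i j. real k * saw_sum n (k - 1) E i j) = (real k)\<^sup>2 * frob_sq n (saw_sum n (k - 1) E)"
      by (rule frob_sq_scale)
    also have "frob_sq n (saw_sum n (k - 1) E) = real n ^ (k - 1) * frob_sq n (saw_mat n (k - 1) E)"
    proof -
      have "saw_sum n (k - 1) E = (\<lambda>i j. sqrt (real n) ^ (k - 1) * saw_mat n (k - 1) E i j)"
        using s(3) by (intro ext) (simp add: saw_mat_def)
      then show ?thesis by (simp only: frob_sq_scale sqrt_power_sq)
    qed
    finally show "frob_sq n (rec_err n k E) \<le> 1 / real n ^ Suc k * (2 * (frob_sq n (cycle_sum n k E) + (real k)\<^sup>2 * (real n ^ (k - 1) * frob_sq n (saw_mat n (k - 1) E))))" .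
  qed
  also have "\<dots> = 1 / real n ^ Suc k * (2 * (avg (all_edges n) (\<lambda>E. frob_sq n (cycle_sum n k E)) +
      (real k)\<^sup>2 * (real n ^ (k - 1) * avg (all_edges n) (\<lambda>E. frob_sq n (saw_mat n (k - 1) E)))))"
    by (simp only: avg_cmult avg_add)
  also have "\<dots> \<le> 1 / real n ^ Suc k * (2 * (?C * real n ^ Suc k + (real k)\<^sup>2 * real n ^ Suc k))"
  proof (intro mult_left_mono add_mono avg_frob_sq_cycle_sum_le)
    have "real n ^ (k - 1) * avg (all_edges n) (\<lambda>E. frob_sq n (saw_mat n (k - 1) E)) \<le> real n ^ (k - 1) * real n"
      using n by (intro mult_left_mono avg_frob_sq_saw_mat_le) auto
    also have "\<dots> = real n ^ Suc (k - 1)" by simp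
    also have "\<dots> \<le> real n ^ Suc k" using n by (intro power_increasing) auto
    finally show "real n ^ (k - 1) * avg (all_edges n) (\<lambda>E. frob_sq n (saw_mat n (k - 1) E)) \<le> real n ^ Suc k" .
  qed auto
  also have "\<dots> = 2 * (?C + (real k)\<^sup>2)"
    using n by (simp add: field_simps)
  finally show "avg (all_edges n) (\<lambda>E. frob_sq n (rec_err n k E)) \<le> 2 * (?C + (real k)\<^sup>2)" .
qed

section \<open>Error matrices whose mean nuclear norm is at most of order
  \<open>sqrt n\<close>\<close>

definition nuc_negligible :: "(nat \<Rightarrow> nat set set \<Rightarrow> nat \<Rightarrow> nat \<Rightarrow> real) \<Rightarrow> bool" where
  "nuc_negligible X \<longleftrightarrow> (\<exists>K. \<forall>n\<ge>1. avg (all_edges n) (\<lambda>E. nuc n (X n E)) \<le> K * sqrt (real n))"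

lemma nuc_negligible_add:
  assumes "nuc_negligible X" "nuc_negligible Y"
    and "\<And>n E i j. i < n \<Longrightarrow> j < n \<Longrightarrow> Z n E i j = X n E i j + Y n E i j"
  shows "nuc_negligible Z"
proof -
  obtain K where K: "\<And>n. n \<ge> 1 \<Longrightarrow> avg (all_edges n) (\<lambda>E. nuc n (X n E)) \<le> K * sqrt (real n)"
    using assms(1) unfolding nuc_negligible_def by blast
  obtain L where L: "\<And>n. n \<ge> 1 \<Longrightarrow> avg (all_edges n) (\<lambda>E. nuc n (Y n E)) \<le> L * sqrt (real n)"
    using assms(2) unfolding nuc_negligible_def by blast
  have "avg (all_edges n) (\<lambda>E. nuc n (Z n E)) \<le> (K + L) * sqrt (real n)" if n: "n \<ge> 1" for n
  proof -
    have "nuc n (Z n E) = nuc n (\<lambda>i j. X n E i j + Y n E i j)" for E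
      by (rule nuc_cong) (simp add: assms(3))
    then have "avg (all_edges n) (\<lambda>E. nuc n (Z n E)) \<le> avg (all_edges n) (\<lambda>E. nuc n (X n E) + nuc n (Y n E))"
      by (intro avg_mono) (simp add: nuc_add_le)
    then show ?thesis using K[OF n] L[OF n] by (simp add: avg_add algebra_simps)
  qed
  then show ?thesis unfolding nuc_negligible_def by blast
qed

lemma nuc_negligible_scale:
  assumes "nuc_negligible X"
    and "\<And>n E i j. i < n \<Longrightarrow> j < n \<Longrightarrow> Z n E i j = a * X n E i j"
  shows "nuc_negligible Z"
proof -
  obtain K where K: "\<And>n. n \<ge> 1 \<Longrightarrow> avg (all_edges n) (\<lambda>E. nuc n (X n E)) \<le> K * sqrt (real n)"
    using assms(1) unfolding nuc_negligible_def by blast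
  have "avg (all_edges n) (\<lambda>E. nuc n (Z n E)) \<le> (\<bar>a\<bar> * K) * sqrt (real n)" if n: "n \<ge> 1" for n
  proof -
    have "nuc n (Z n E) = nuc n (\<lambda>i j. a * X n E i j)" for E
      by (rule nuc_cong) (simp add: assms(2))
    then have "avg (all_edges n) (\<lambda>E. nuc n (Z n E)) \<le> avg (all_edges n) (\<lambda>E. \<bar>a\<bar> * nuc n (X n E))"
      by (intro avg_mono) (simp add: nuc_scale_le)
    then show ?thesis using mult_left_mono[OF K[OF n], of "\<bar>a\<bar>"] by (simp add: avg_cmult mult.assoc)
  qed
  then show ?thesis unfolding nuc_negligible_def by blast
qed

lemma nuc_negligible_zero:
  assumes "\<And>n E i j. i < n \<Longrightarrow> j < n \<Longrightarrow> X n E i j = 0"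
  shows "nuc_negligible X"
  unfolding nuc_negligible_def
proof (intro exI[of _ 0] allI impI)
  fix n :: nat
  have "nuc n (X n E) \<le> 0" for E
    using nuc_le_sum_abs[of n "X n E"] assms by simp
  then show "avg (all_edges n) (\<lambda>E. nuc n (X n E)) \<le> 0 * sqrt (real n)"
    using avg_mono[of "all_edges n" "\<lambda>E. nuc n (X n E)" "\<lambda>E. 0"] finite_all_edges[of n] by (simp add: avg_const)
qed

text \<open>The weighted Hoelder bound with \<open>s = sqrt n\<close> balances the squared norms
  \<open>n\<close> and \<open>K\<close>, so that each contributes order
  \<open>sqrt n\<close>.\<close>

lemma nuc_negligible_prod:
  assumes "\<And>n. n \<ge> 1 \<Longrightarrow> avg (all_edges n) (\<lambda>E. frob_sq n (X n E)) \<le> real n"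
    and "\<And>n. n \<ge> 1 \<Longrightarrow> avg (all_edges n) (\<lambda>E. frob_sq n (Y n E)) \<le> K"
  shows "nuc_negligible (\<lambda>n E. mat_prod n (X n E) (Y n E))" "nuc_negligible (\<lambda>n E. mat_prod n (Y n E) (X n E))"
proof -
  have *: "s * avg (all_edges n) (\<lambda>E. frob_sq n (Y n E)) + avg (all_edges n) (\<lambda>E. frob_sq n (X n E)) / s \<le> (K + 1) * s"
    if n: "n \<ge> 1" and s: "s = sqrt (real n)" for n s
  proof -
    have "s > 0" "s * s = real n" using n s by auto
    then have "avg (all_edges n) (\<lambda>E. frob_sq n (X n E)) / s \<le> s"
      using assms(1)[OF n] by (simp add: field_simps)
    moreover have "s * avg (all_edges n) (\<lambda>E. frob_sq n (Y n E)) \<le> s * K"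
      using assms(2)[OF n] \<open>s > 0\<close> by (intro mult_left_mono) auto
    ultimately show ?thesis by (simp add: algebra_simps)
  qed
  show "nuc_negligible (\<lambda>n E. mat_prod n (X n E) (Y n E))"
    unfolding nuc_negligible_def
  proof (intro exI[of _ "(K + 1) / 2"] allI impI)
    fix n :: nat assume n: "n \<ge> 1"
    define s where "s = sqrt (real n)"
    have s: "s > 0" using n by (simp add: s_def)
    have "avg (all_edges n) (\<lambda>E. nuc n (mat_prod n (X n E) (Y n E))) \<le>
        avg (all_edges n) (\<lambda>E. (frob_sq n (X n E) / s + s * frob_sq n (Y n E)) / 2)"
      using nuc_prod_le_weighted[of "1 / s" n] s by (intro avg_mono) (simp add: mult.commute)
    also have "\<dots> = (avg (all_edges n) (\<lambda>E. frob_sq n (X n E)) / s + s * avg (all_edges n) (\<lambda>E. frob_sq n (Y n E))) / 2"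
      by (simp only: avg_divide avg_add avg_cmult)
    finally show "avg (all_edges n) (\<lambda>E. nuc n (mat_prod n (X n E) (Y n E))) \<le> (K + 1) / 2 * sqrt (real n)"
      using *[OF n s_def] by (simp add: s_def)
  qed
  show "nuc_negligible (\<lambda>n E. mat_prod n (Y n E) (X n E))"
    unfolding nuc_negligible_def
  proof (intro exI[of _ "(K + 1) / 2"] allI impI)
    fix n :: nat assume n: "n \<ge> 1"
    define s where "s = sqrt (real n)"
    have s: "s > 0" using n by (simp add: s_def)
    have "avg (all_edges n) (\<lambda>E. nuc n (mat_prod n (Y n E) (X n E))) \<le>
        avg (all_edges n) (\<lambda>E. (s * frob_sq n (Y n E) + frob_sq n (X n E) / s) / 2)"
      by (intro avg_mono nuc_prod_le_weighted s)
    also have "\<dots> = (s * avg (all_edges n) (\<lambda>E. frob_sq n (Y n E)) + avg (all_edges n) (\<lambda>E. frob_sq n (X n E)) / s) / 2"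
      by (simp only: avg_divide avg_add avg_cmult)
    finally show "avg (all_edges n) (\<lambda>E. nuc n (mat_prod n (Y n E) (X n E))) \<le> (K + 1) / 2 * sqrt (real n)"
      using *[OF n s_def] by (simp add: s_def)
  qed
qed

text \<open>Quantifying over all large \<open>N\<close> forces \<open>c\<close> to vanish eventually, which spares padding when
  expansions are added.\<close>

definition cheb_approx :: "(nat \<Rightarrow> nat set set \<Rightarrow> nat \<Rightarrow> nat \<Rightarrow> real) \<Rightarrow> (real \<Rightarrow> real) \<Rightarrow> bool" where
  "cheb_approx X f \<longleftrightarrow> (\<exists>N0 c. \<forall>N\<ge>N0. (\<forall>x. f x = (\<Sum>k\<le>N. c k * cheb k x)) \<and>
     nuc_negligible (\<lambda>n E i j. X n E i j - (\<Sum>k\<le>N. c k * saw_mat n k E i j)))"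

lemma cheb_approxI:
  assumes "\<And>N x. N \<ge> M \<Longrightarrow> f x = (\<Sum>k\<le>N. c k * cheb k x)"
    "\<And>N. N \<ge> M \<Longrightarrow> nuc_negligible (\<lambda>n E i j. X n E i j - (\<Sum>k\<le>N. c k * saw_mat n k E i j))"
  shows "cheb_approx X f"
  unfolding cheb_approx_def using assms by (intro exI[of _ M] exI[of _ c]) blast

lemma cheb_approx_saw_mat: "cheb_approx (\<lambda>n. saw_mat n a) (cheb a)"
proof (rule cheb_approxI[where M = a and c = "\<lambda>k. of_bool (k = a)"])
  fix N x assume "N \<ge> a"
  then show "cheb a x = (\<Sum>k\<le>N. of_bool (k = a) * cheb k x)"
    by (simp add: of_bool_def if_distrib[of "\<lambda>x. x * _"] cong: if_cong)
next
  fix N assume "N \<ge> a"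
  then have "(\<Sum>k\<le>N. of_bool (k = a) * saw_mat n k E i j) = saw_mat n a E i j" for n E i j
    by (simp add: of_bool_def if_distrib[of "\<lambda>x. x * _"] cong: if_cong)
  then show "nuc_negligible (\<lambda>n E i j. saw_mat n a E i j - (\<Sum>k\<le>N. of_bool (k = a) * saw_mat n k E i j))"
    by (intro nuc_negligible_zero) simp
qed

lemma cheb_approx_add:
  assumes "cheb_approx X f" "cheb_approx Y g"
  shows "cheb_approx (\<lambda>n E i j. X n E i j + Y n E i j) (\<lambda>x. f x + g x)"
proof -
  obtain N1 c where c: "\<And>N x. N \<ge> N1 \<Longrightarrow> f x = (\<Sum>k\<le>N. c k * cheb k x)"
    "\<And>N. N \<ge> N1 \<Longrightarrow> nuc_negligible (\<lambda>n E i j. X n E i j - (\<Sum>k\<le>N. c k * saw_mat n k E i j))"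
    using assms(1) unfolding cheb_approx_def by blast
  obtain N2 d where d: "\<And>N x. N \<ge> N2 \<Longrightarrow> g x = (\<Sum>k\<le>N. d k * cheb k x)"
    "\<And>N. N \<ge> N2 \<Longrightarrow> nuc_negligible (\<lambda>n E i j. Y n E i j - (\<Sum>k\<le>N. d k * saw_mat n k E i j))"
    using assms(2) unfolding cheb_approx_def by blast
  show ?thesis
  proof (rule cheb_approxI[where M = "max N1 N2" and c = "\<lambda>k. c k + d k"])
    fix N x assume "N \<ge> max N1 N2"
    then show "f x + g x = (\<Sum>k\<le>N. (c k + d k) * cheb k x)"
      using c(1)[of N x] d(1)[of N x] by (simp add: distrib_right sum.distrib)
  next
    fix N assume "N \<ge> max N1 N2"
    then show "nuc_negligible (\<lambda>n E i j. X n E i j + Y n E i j - (\<Sum>k\<le>N. (c k + d k) * saw_mat n k E i j))"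
      by (intro nuc_negligible_add[OF c(2)[of N] d(2)[of N]]) (simp_all add: distrib_right sum.distrib)
  qed
qed

lemma cheb_approx_scale:
  assumes "cheb_approx X f"
  shows "cheb_approx (\<lambda>n E i j. a * X n E i j) (\<lambda>x. a * f x)"
proof -
  obtain N1 c where c: "\<And>N x. N \<ge> N1 \<Longrightarrow> f x = (\<Sum>k\<le>N. c k * cheb k x)"
    "\<And>N. N \<ge> N1 \<Longrightarrow> nuc_negligible (\<lambda>n E i j. X n E i j - (\<Sum>k\<le>N. c k * saw_mat n k E i j))"
    using assms(1) unfolding cheb_approx_def by blast
  show ?thesis
  proof (rule cheb_approxI[where M = N1 and c = "\<lambda>k. a * c k"])
    fix N x assume "N \<ge> N1"
    then show "a * f x = (\<Sum>k\<le>N. a * c k * cheb k x)"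
      using c(1)[of N x] by (simp add: sum_distrib_left mult.assoc)
  next
    fix N assume "N \<ge> N1"
    then show "nuc_negligible (\<lambda>n E i j. a * X n E i j - (\<Sum>k\<le>N. a * c k * saw_mat n k E i j))"
      by (intro nuc_negligible_scale[OF c(2)[of N], where a = a]) (simp_all add: algebra_simps sum_distrib_left)
  qed
qed

lemma cheb_approx_diff:
  assumes "cheb_approx X f" "cheb_approx Y g"
  shows "cheb_approx (\<lambda>n E i j. X n E i j - Y n E i j) (\<lambda>x. f x - g x)"
  using cheb_approx_add[OF assms(1) cheb_approx_scale[OF assms(2), of "-1"]] by simp

lemma cheb_approx_sum:
  fixes m :: nat
  assumes "\<And>k. k \<le> m \<Longrightarrow> cheb_approx (X k) (f k)"
  shows "cheb_approx (\<lambda>n E i j. \<Sum>k\<le>m. X k n E i j) (\<lambda>x. \<Sum>k\<le>m. f k x)"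
  using assms by (induction m) (auto intro: cheb_approx_add)

lemma cheb_approx_perturb:
  assumes "cheb_approx X f" "nuc_negligible Y"
    and "\<And>n E i j. i < n \<Longrightarrow> j < n \<Longrightarrow> Z n E i j = X n E i j + Y n E i j"
  shows "cheb_approx Z f"
proof -
  obtain N1 c where c: "\<And>N x. N \<ge> N1 \<Longrightarrow> f x = (\<Sum>k\<le>N. c k * cheb k x)"
    "\<And>N. N \<ge> N1 \<Longrightarrow> nuc_negligible (\<lambda>n E i j. X n E i j - (\<Sum>k\<le>N. c k * saw_mat n k E i j))"
    using assms(1) unfolding cheb_approx_def by blast
  show ?thesis
  proof (rule cheb_approxI[where M = N1 and c = c])
    fix N assume "N \<ge> N1"
    then show "nuc_negligible (\<lambda>n E i j. Z n E i j - (\<Sum>k\<le>N. c k * saw_mat n k E i j))"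
      by (intro nuc_negligible_add[OF c(2)[of N] assms(2)]) (simp_all add: assms(3))
  qed (rule c(1))
qed

lemma cheb_approx_cong:
  assumes "cheb_approx X f" "\<And>n E i j. i < n \<Longrightarrow> j < n \<Longrightarrow> Z n E i j = X n E i j"
  shows "cheb_approx Z f"
  using assms(1) nuc_negligible_zero[of "\<lambda>n E i j. 0"]
  by (rule cheb_approx_perturb) (simp_all add: assms(2))

section \<open>The Chebyshev product rule for walk matrices\<close>

definition cheb_pred :: "nat \<Rightarrow> real \<Rightarrow> real" where
  "cheb_pred k x = (if k = 0 then 0 else cheb (k - 1) x)"

lemma x_mult_cheb: "x * cheb k x = cheb (Suc k) x + cheb_pred k x"
  by (cases k) (auto simp: cheb_pred_def)

lemma norm_mat_symmetric: "norm_mat n E i j = norm_mat n E j i"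
  by (simp add: norm_mat_def sign_mat_def insert_commute)

lemma norm_mat_saw_mat:
  "mat_prod n (norm_mat n E) (saw_mat n k E) i j = saw_mat n (Suc k) E i j + saw_mat_pred n k E i j + rec_err n k E i j"
  by (simp add: rec_err_def)

text \<open>For symmetric matrices, exchanging the factors transposes the product; the error
  therefore appears with its indices swapped.\<close>

lemma saw_mat_norm_mat:
  assumes "i < n" "j < n"
  shows "mat_prod n (saw_mat n k E) (norm_mat n E) i j = saw_mat n (Suc k) E i j + saw_mat_pred n k E i j + rec_err n k E j i"
proof -
  have "mat_prod n (saw_mat n k E) (norm_mat n E) i j = mat_prod n (norm_mat n E) (saw_mat n k E) j i"
    using assms by (intro mat_prod_symmetric_swap saw_mat_symmetric norm_mat_symmetric)
  then show ?thesis
    by (simp add: norm_mat_saw_mat saw_mat_symmetric[of n _ E j i] saw_mat_pred_def)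
qed

lemma mat_prod_cong:
  assumes "\<And>k. k < n \<Longrightarrow> X i k = X' i k" "\<And>k. k < n \<Longrightarrow> Y k j = Y' k j"
  shows "mat_prod n X Y i j = mat_prod n X' Y' i j"
  unfolding mat_prod_def using assms by (intro sum.cong) auto

lemma mat_prod_add_left: "mat_prod n (\<lambda>i j. X i j + Y i j) Z i j = mat_prod n X Z i j + mat_prod n Y Z i j"
  by (simp add: mat_prod_def distrib_right sum.distrib)

lemma mat_prod_add_right: "mat_prod n Z (\<lambda>i j. X i j + Y i j) i j = mat_prod n Z X i j + mat_prod n Z Y i j"
  by (simp add: mat_prod_def distrib_left sum.distrib)

lemma nuc_negligible_saw_mat_rec_err:
  "nuc_negligible (\<lambda>n E. mat_prod n (saw_mat n a E) (rec_err n b E))"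
  "nuc_negligible (\<lambda>n E. mat_prod n (\<lambda>i j. rec_err n b E j i) (saw_mat n a E))"
proof -
  obtain K where K: "\<And>n. n \<ge> 1 \<Longrightarrow> avg (all_edges n) (\<lambda>E. frob_sq n (rec_err n b E)) \<le> K"
    using avg_frob_sq_rec_err_le by blast
  show "nuc_negligible (\<lambda>n E. mat_prod n (saw_mat n a E) (rec_err n b E))"
    using avg_frob_sq_saw_mat_le K by (rule nuc_negligible_prod(1))
  show "nuc_negligible (\<lambda>n E. mat_prod n (\<lambda>i j. rec_err n b E j i) (saw_mat n a E))"
  proof (rule nuc_negligible_prod(2)[OF avg_frob_sq_saw_mat_le])
    fix n :: nat assume "n \<ge> 1"
    moreover have "frob_sq n (\<lambda>i j. rec_err n b E j i) = frob_sq n (rec_err n b E)" for E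
      by (rule frob_sq_transpose)
    ultimately show "avg (all_edges n) (\<lambda>E. frob_sq n (\<lambda>i j. rec_err n b E j i)) \<le> K"
      using K by (simp only:)
  qed
qed

lemma mat_prod_saw_mat_0:
  "i < n \<Longrightarrow> mat_prod n (saw_mat n 0 E) X i j = X i j"
  using mat_prod_id_left[of i n X j] mat_prod_cong[of n "saw_mat n 0 E" i id_mat X j X] saw_mat_0 by simp

lemma nuc_negligible_rec_err: "nuc_negligible (\<lambda>n. rec_err n b)"
  by (rule nuc_negligible_scale[OF nuc_negligible_saw_mat_rec_err(1)[of 0 b], where a = 1])
    (simp add: mat_prod_saw_mat_0)

lemma cheb_approx_zero: "cheb_approx (\<lambda>n E i j. 0) (\<lambda>x. 0)"
  using cheb_approx_scale[OF cheb_approx_saw_mat[of 0], of 0] by simp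

text \<open>Evaluating \<open>T\<^sub>a\<^sub>+\<^sub>1 H T\<^sub>b\<close> in both ways of bracketing raises \<open>a\<close> at the expense of \<open>b\<close>. The error
  terms are multiplied only by some \<open>T\<^sub>k\<close>, never by \<open>H\<close>, so no bound on the operator norm of \<open>H\<close> is needed.\<close>

lemma cheb_approx_saw_mat_prod:
  "cheb_approx (\<lambda>n E. mat_prod n (saw_mat n a E) (saw_mat n b E)) (\<lambda>x. cheb a x * cheb b x)"
proof (induction a arbitrary: b rule: induct_nat_012)
  case 0
  show ?case
    using cheb_approx_cong[OF cheb_approx_saw_mat[of b], of "\<lambda>n E. mat_prod n (saw_mat n 0 E) (saw_mat n b E)"]
    by (simp add: mat_prod_saw_mat_0)
next
  \<comment> \<open>This case is the three-term recurrence itself.\<close>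
  case 1
  have "cheb_approx (\<lambda>n. saw_mat_pred n b) (cheb_pred b)"
    using cheb_approx_zero cheb_approx_saw_mat[of "b - 1"]
    by (cases "b = 0") (simp_all add: saw_mat_pred_def[abs_def] cheb_pred_def[abs_def])
  from cheb_approx_add[OF cheb_approx_saw_mat[of "Suc b"] this]
  have "cheb_approx (\<lambda>n E i j. saw_mat n (Suc b) E i j + saw_mat_pred n b E i j) (\<lambda>x. cheb (Suc 0) x * cheb b x)"
    by (simp add: x_mult_cheb)
  then show ?case
  proof (rule cheb_approx_perturb[OF _ nuc_negligible_rec_err[of b]])
    fix n E i j assume "i < n" "j < (n :: nat)"
    then have "mat_prod n (saw_mat n (Suc 0) E) (saw_mat n b E) i j = mat_prod n (norm_mat n E) (saw_mat n b E) i j"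
      by (intro mat_prod_cong saw_mat_1 refl)
    then show "mat_prod n (saw_mat n (Suc 0) E) (saw_mat n b E) i j =
        saw_mat n (Suc b) E i j + saw_mat_pred n b E i j + rec_err n b E i j"
      by (simp add: norm_mat_saw_mat)
  qed
next
  case (ge2 a)
  have pred: "cheb_approx (\<lambda>n E. mat_prod n (saw_mat n (Suc a) E) (saw_mat_pred n b E)) (\<lambda>x. cheb (Suc a) x * cheb_pred b x)"
    using cheb_approx_zero ge2(2)[of "b - 1"]
    by (cases "b = 0") (simp_all add: saw_mat_pred_def[abs_def] cheb_pred_def[abs_def] mat_prod_def[abs_def])
  \<comment> \<open>Solving \<open>T\<^sub>a\<^sub>+\<^sub>1 (H T\<^sub>b) =
    (T\<^sub>a\<^sub>+\<^sub>1 H) T\<^sub>b\<close> for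
    \<open>T\<^sub>a\<^sub>+\<^sub>2 T\<^sub>b\<close> leaves the error of the first bracketing with
    a plus sign and that of the second with a minus sign.\<close>
  let ?R = "\<lambda>n E i j. mat_prod n (saw_mat n (Suc a) E) (rec_err n b E) i j +
    (-1) * mat_prod n (\<lambda>i j. rec_err n (Suc a) E j i) (saw_mat n b E) i j"
  have R: "nuc_negligible ?R"
  proof (rule nuc_negligible_add[OF nuc_negligible_saw_mat_rec_err(1)])
    show "nuc_negligible (\<lambda>n E i j. (-1) * mat_prod n (\<lambda>i j. rec_err n (Suc a) E j i) (saw_mat n b E) i j)"
      by (rule nuc_negligible_scale[OF nuc_negligible_saw_mat_rec_err(2)[where a = b and b = "Suc a"], where a = "-1"]) simp
  qed simp
  have "cheb_approx (\<lambda>n E i j. mat_prod n (saw_mat n (Suc a) E) (saw_mat n (Suc b) E) i j +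
      mat_prod n (saw_mat n (Suc a) E) (saw_mat_pred n b E) i j - mat_prod n (saw_mat n a E) (saw_mat n b E) i j)
      (\<lambda>x. cheb (Suc a) x * cheb (Suc b) x + cheb (Suc a) x * cheb_pred b x - cheb a x * cheb b x)"
    by (intro cheb_approx_diff cheb_approx_add ge2 pred)
  moreover have "cheb (Suc a) x * cheb (Suc b) x + cheb (Suc a) x * cheb_pred b x - cheb a x * cheb b x =
      cheb (Suc (Suc a)) x * cheb b x" for x
  proof -
    have "cheb (Suc a) x * cheb (Suc b) x + cheb (Suc a) x * cheb_pred b x = cheb (Suc a) x * (x * cheb b x)"
      by (simp only: x_mult_cheb distrib_left)
    then show ?thesis by (simp add: algebra_simps)
  qed
  ultimately have "cheb_approx (\<lambda>n E i j. mat_prod n (saw_mat n (Suc a) E) (saw_mat n (Suc b) E) i j +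
      mat_prod n (saw_mat n (Suc a) E) (saw_mat_pred n b E) i j - mat_prod n (saw_mat n a E) (saw_mat n b E) i j)
      (\<lambda>x. cheb (Suc (Suc a)) x * cheb b x)"
    by (simp only:)
  then show ?case
  proof (rule cheb_approx_perturb[OF _ R])
    fix n E i j assume ij: "i < n" "j < (n :: nat)"
    have "saw_mat_pred n (Suc a) E = saw_mat n a E"
      by (simp add: saw_mat_pred_def[abs_def])
    then have "mat_prod n (mat_prod n (saw_mat n (Suc a) E) (norm_mat n E)) (saw_mat n b E) i j =
        mat_prod n (\<lambda>i j. saw_mat n (Suc (Suc a)) E i j + saw_mat n a E i j + rec_err n (Suc a) E j i) (saw_mat n b E) i j"
      using ij by (intro mat_prod_cong) (simp_all add: saw_mat_norm_mat)
    moreover have "mat_prod n (norm_mat n E) (saw_mat n b E) =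
        (\<lambda>i j. saw_mat n (Suc b) E i j + saw_mat_pred n b E i j + rec_err n b E i j)"
      by (intro ext norm_mat_saw_mat)
    ultimately show "mat_prod n (saw_mat n (Suc (Suc a)) E) (saw_mat n b E) i j =
        mat_prod n (saw_mat n (Suc a) E) (saw_mat n (Suc b) E) i j +
        mat_prod n (saw_mat n (Suc a) E) (saw_mat_pred n b E) i j -
        mat_prod n (saw_mat n a E) (saw_mat n b E) i j + ?R n E i j"
      using mat_prod_assoc[of n "saw_mat n (Suc a) E" "norm_mat n E" "saw_mat n b E" i j]
      by (simp add: mat_prod_add_left mat_prod_add_right)
  qed
qed

lemma cheb_approx_comb_prod:
  "cheb_approx (\<lambda>n E. mat_prod n (\<lambda>i j. \<Sum>a\<le>N. p a * saw_mat n a E i j) (\<lambda>i j. \<Sum>b\<le>M. q b * saw_mat n b E i j))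
    (\<lambda>x. (\<Sum>a\<le>N. p a * cheb a x) * (\<Sum>b\<le>M. q b * cheb b x))"
proof -
  have eq: "mat_prod n (\<lambda>i j. \<Sum>a\<le>N. p a * saw_mat n a E i j) (\<lambda>i j. \<Sum>b\<le>M. q b * saw_mat n b E i j) i j =
      (\<Sum>a\<le>N. \<Sum>b\<le>M. p a * q b * mat_prod n (saw_mat n a E) (saw_mat n b E) i j)" for n E i j
  proof -
    let ?t = "\<lambda>a b k. p a * q b * (saw_mat n a E i k * saw_mat n b E k j)"
    have "mat_prod n (\<lambda>i j. \<Sum>a\<le>N. p a * saw_mat n a E i j) (\<lambda>i j. \<Sum>b\<le>M. q b * saw_mat n b E i j) i j =
        (\<Sum>k<n. \<Sum>a\<le>N. \<Sum>b\<le>M. ?t a b k)"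
      unfolding mat_prod_def sum_product by (intro sum.cong refl) simp
    also have "\<dots> = (\<Sum>a\<le>N. \<Sum>k<n. \<Sum>b\<le>M. ?t a b k)"
      by (rule sum.swap)
    also have "\<dots> = (\<Sum>a\<le>N. \<Sum>b\<le>M. \<Sum>k<n. ?t a b k)"
      by (intro sum.cong refl sum.swap)
    finally show ?thesis by (simp only: mat_prod_def sum_distrib_left)
  qed
  have "cheb_approx (\<lambda>n E i j. \<Sum>a\<le>N. \<Sum>b\<le>M. p a * q b * mat_prod n (saw_mat n a E) (saw_mat n b E) i j)
    (\<lambda>x. \<Sum>a\<le>N. \<Sum>b\<le>M. p a * q b * (cheb a x * cheb b x))"
    by (intro cheb_approx_sum cheb_approx_scale cheb_approx_saw_mat_prod)
  moreover have "(\<Sum>a\<le>N. \<Sum>b\<le>M. p a * q b * (cheb a x * cheb b x)) =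
      (\<Sum>a\<le>N. p a * cheb a x) * (\<Sum>b\<le>M. q b * cheb b x)" for x
    unfolding sum_product by (intro sum.cong refl) simp
  ultimately have "cheb_approx (\<lambda>n E i j. \<Sum>a\<le>N. \<Sum>b\<le>M. p a * q b * mat_prod n (saw_mat n a E) (saw_mat n b E) i j)
    (\<lambda>x. (\<Sum>a\<le>N. p a * cheb a x) * (\<Sum>b\<le>M. q b * cheb b x))"
    by (simp only:)
  then show ?thesis by (rule cheb_approx_cong) (rule eq)
qed

section \<open>The mean nuclear norm and concentration\<close>

text \<open>Decompose \<open>H\<close> as \<open>A B + D\<close> plus a negligible matrix, where
  \<open>A\<close> and \<open>B\<close> realise the two root approximations and \<open>D\<close>
  realises \<open>x - P x * Q x\<close>. Per unit of \<open>n\<close>, the product costs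
  \<open>8 / (3 * pi) + 4 * d\<close> and \<open>D\<close> costs \<open>4 * d\<close>.\<close>

lemma avg_nuc_norm_mat_le:
  assumes d: "0 < d" "d \<le> 1"
  shows "\<exists>K. \<forall>n\<ge>1. avg (all_edges n) (\<lambda>E. nuc n (norm_mat n E)) \<le> (8 / (3 * pi) + 8 * d) * real n + K * sqrt (real n)"
proof -
  have abs_sqrt: "\<bar>sqrt x\<bar> = sqrt \<bar>x\<bar>" for x
    by (cases "x \<ge> 0") (auto simp: real_sqrt_minus)
  obtain P N p where P: "\<And>x. P x = (\<Sum>k\<le>N. p k * cheb k x)" "\<And>x. \<bar>x\<bar> \<le> 2 \<Longrightarrow> \<bar>P x - sqrt \<bar>x\<bar>\<bar> < d"
      "(\<Sum>k\<le>N. (p k)\<^sup>2) \<le> 8 / (3 * pi) + 4 * d"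
    by (rule approx_sqrt_cheb[of "\<lambda>x. sqrt \<bar>x\<bar>" d]) (use d in \<open>auto intro!: continuous_intros\<close>)
  \<comment> \<open>For negative arguments \<open>sqrt x = - sqrt (- x)\<close>, so the second factor approximates the odd square root.\<close>
  obtain Q M q where Q: "\<And>x. Q x = (\<Sum>k\<le>M. q k * cheb k x)" "\<And>x. \<bar>x\<bar> \<le> 2 \<Longrightarrow> \<bar>Q x - sqrt x\<bar> < d"
      "(\<Sum>k\<le>M. (q k)\<^sup>2) \<le> 8 / (3 * pi) + 4 * d"
    by (rule approx_sqrt_cheb[of sqrt d]) (use d in \<open>auto intro!: continuous_intros simp: abs_sqrt\<close>)
  define A where "A = (\<lambda>n E i j. \<Sum>k\<le>N. p k * saw_mat n k E i j)"
  define B where "B = (\<lambda>n E i j. \<Sum>k\<le>M. q k * saw_mat n k E i j)"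
  have "cheb_approx (\<lambda>n E i j. saw_mat n (Suc 0) E i j - mat_prod n (A n E) (B n E) i j) (\<lambda>x. cheb (Suc 0) x - P x * Q x)"
    unfolding P(1) Q(1) A_def B_def by (intro cheb_approx_diff cheb_approx_saw_mat cheb_approx_comb_prod)
  then obtain R r where r: "\<And>x. x - P x * Q x = (\<Sum>k\<le>R. r k * cheb k x)"
    and neg: "nuc_negligible (\<lambda>n E i j. saw_mat n (Suc 0) E i j - mat_prod n (A n E) (B n E) i j - (\<Sum>k\<le>R. r k * saw_mat n k E i j))"
    unfolding cheb_approx_def by auto
  define D where "D = (\<lambda>n E i j. \<Sum>k\<le>R. r k * saw_mat n k E i j)"
  \<comment> \<open>The constant 4 is \<open>3 / 2 + 5 / 2\<close>, from the bounds on
    \<open>sqrt \<bar>x\<bar>\<close> and \<open>\<bar>Q x\<bar>\<close>.\<close>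
  have "(x - P x * Q x)\<^sup>2 \<le> 0 * \<bar>x\<bar> + (4 * d)\<^sup>2" if x: "\<bar>x\<bar> \<le> 2" for x
  proof -
    have s: "sqrt \<bar>x\<bar> \<le> 3 / 2" using x by (intro real_le_lsqrt) (auto simp: power2_eq_square)
    have Qx: "\<bar>Q x\<bar> \<le> 5 / 2" using Q(2)[OF x] s abs_sqrt[of x] d by linarith
    have "x = sqrt \<bar>x\<bar> * sqrt x" by (cases "x \<ge> 0") (auto simp: real_sqrt_minus)
    then have "\<bar>x - P x * Q x\<bar> = \<bar>sqrt \<bar>x\<bar> * (sqrt x - Q x) + Q x * (sqrt \<bar>x\<bar> - P x)\<bar>"
      by (simp add: algebra_simps)
    also have "\<dots> \<le> \<bar>sqrt \<bar>x\<bar>\<bar> * \<bar>sqrt x - Q x\<bar> + \<bar>Q x\<bar> * \<bar>sqrt \<bar>x\<bar> - P x\<bar>"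
      unfolding abs_mult[symmetric] by (rule abs_triangle_ineq)
    also have "\<dots> \<le> 3 / 2 * d + 5 / 2 * d"
      using s Qx P(2)[OF x] Q(2)[OF x] d by (intro add_mono mult_mono) auto
    finally have "\<bar>x - P x * Q x\<bar> \<le> 4 * d" by simp
    then have "\<bar>x - P x * Q x\<bar>\<^sup>2 \<le> (4 * d)\<^sup>2" by (intro power_mono) auto
    then show ?thesis by simp
  qed
  then have R: "(\<Sum>k\<le>R. (r k)\<^sup>2) \<le> (4 * d)\<^sup>2"
    using sum_coeffs_le[of "\<lambda>x. x - P x * Q x" r R 0 "(4 * d)\<^sup>2"] r by simp
  obtain K where K: "\<And>n. n \<ge> 1 \<Longrightarrow> avg (all_edges n) (\<lambda>E. nuc n (\<lambda>i j. saw_mat n (Suc 0) E i j - mat_prod n (A n E) (B n E) i j - D n E i j)) \<le> K * sqrt (real n)"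
    using neg unfolding nuc_negligible_def D_def by blast
  have "avg (all_edges n) (\<lambda>E. nuc n (norm_mat n E)) \<le> (8 / (3 * pi) + 8 * d) * real n + K * sqrt (real n)"
    if n: "n \<ge> 1" for n
  proof -
    have "avg (all_edges n) (\<lambda>E. nuc n (norm_mat n E)) \<le>
        avg (all_edges n) (\<lambda>E. (frob_sq n (A n E) + frob_sq n (B n E)) / 2 + (4 * d * real n + frob_sq n (D n E) / (4 * d)) / 2 +
          nuc n (\<lambda>i j. saw_mat n (Suc 0) E i j - mat_prod n (A n E) (B n E) i j - D n E i j))"
    proof (rule avg_mono)
      fix E
      let ?Y = "\<lambda>i j. saw_mat n (Suc 0) E i j - mat_prod n (A n E) (B n E) i j - D n E i j"
      have "nuc n (norm_mat n E) = nuc n (\<lambda>i j. mat_prod n (A n E) (B n E) i j + (D n E i j + ?Y i j))"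
        by (rule nuc_cong) (simp add: saw_mat_1)
      also have "\<dots> \<le> nuc n (mat_prod n (A n E) (B n E)) + nuc n (\<lambda>i j. D n E i j + ?Y i j)"
        by (rule nuc_add_le)
      finally have "nuc n (norm_mat n E) \<le> nuc n (mat_prod n (A n E) (B n E)) + nuc n (\<lambda>i j. D n E i j + ?Y i j)" .
      moreover have "nuc n (\<lambda>i j. D n E i j + ?Y i j) \<le> nuc n (D n E) + nuc n ?Y"
        by (rule nuc_add_le)
      moreover have "nuc n (mat_prod n (A n E) (B n E)) \<le> (frob_sq n (A n E) + frob_sq n (B n E)) / 2"
        using nuc_prod_le_weighted[of 1 n "A n E" "B n E"] by simp
      \<comment> \<open>The weight \<open>4 * d\<close> balances \<open>n\<close> against the mean
        squared Frobenius norm of \<open>D\<close>, which is at most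
        \<open>(4 * d)\<^sup>2 * n\<close>.\<close>
      moreover have "nuc n (D n E) \<le> (4 * d * real n + frob_sq n (D n E) / (4 * d)) / 2"
        using d by (intro nuc_le_frob_sq) simp
      ultimately show "nuc n (norm_mat n E) \<le> (frob_sq n (A n E) + frob_sq n (B n E)) / 2 +
          (4 * d * real n + frob_sq n (D n E) / (4 * d)) / 2 + nuc n ?Y"
        by linarith
    qed
    also have "\<dots> = (avg (all_edges n) (\<lambda>E. frob_sq n (A n E)) + avg (all_edges n) (\<lambda>E. frob_sq n (B n E))) / 2 +
        (4 * d * real n + avg (all_edges n) (\<lambda>E. frob_sq n (D n E)) / (4 * d)) / 2 +
        avg (all_edges n) (\<lambda>E. nuc n (\<lambda>i j. saw_mat n (Suc 0) E i j - mat_prod n (A n E) (B n E) i j - D n E i j))"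
      by (simp only: avg_add avg_divide avg_const[OF finite_all_edges])
    also have "\<dots> \<le> ((8 / (3 * pi) + 4 * d) * real n + (8 / (3 * pi) + 4 * d) * real n) / 2 +
        (4 * d * real n + (real n * (4 * d)\<^sup>2) / (4 * d)) / 2 + K * sqrt (real n)"
    proof (intro add_mono divide_right_mono K n order_refl)
      have comb: "avg (all_edges n) (\<lambda>E. frob_sq n (\<lambda>i j. \<Sum>k\<le>L. c k * saw_mat n k E i j)) \<le> b * real n"
        if "(\<Sum>k\<le>L. (c k)\<^sup>2) \<le> b" for L c b
        using avg_frob_sq_saw_comb_le[OF n, of c L] mult_left_mono[OF that, of "real n"] by (simp add: mult.commute)
      show "avg (all_edges n) (\<lambda>E. frob_sq n (A n E)) \<le> (8 / (3 * pi) + 4 * d) * real n"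
        unfolding A_def by (rule comb[OF P(3)])
      show "avg (all_edges n) (\<lambda>E. frob_sq n (B n E)) \<le> (8 / (3 * pi) + 4 * d) * real n"
        unfolding B_def by (rule comb[OF Q(3)])
      show "avg (all_edges n) (\<lambda>E. frob_sq n (D n E)) \<le> real n * (4 * d)\<^sup>2"
        unfolding D_def using comb[OF R] by (simp only: mult.commute)
    qed (use d in auto)
    also have "\<dots> = (8 / (3 * pi) + 8 * d) * real n + K * sqrt (real n)"
      using d by (simp add: power2_eq_square algebra_simps)
    finally show ?thesis .
  qed
  then show ?thesis by blast
qed

definition mean_nuc :: "nat \<Rightarrow> real" where
  "mean_nuc n = avg (all_edges n) (\<lambda>E. nuc n (sign_mat E)) / (real n * sqrt (real n))"

lemma eventually_mean_nuc_le:
  assumes "e > 0"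
  shows "\<forall>\<^sub>F n in sequentially. mean_nuc n \<le> 8 / (3 * pi) + e"
proof -
  \<comment> \<open>Half of \<open>e\<close> pays for the approximation error \<open>8 * d\<close>,
    the other half for \<open>K / sqrt n\<close>.\<close>
  define d where "d = min 1 (e / 16)"
  have d: "0 < d" "d \<le> 1" "8 * d \<le> e / 2" using assms by (auto simp: d_def)
  obtain K where K: "\<And>n. n \<ge> 1 \<Longrightarrow> avg (all_edges n) (\<lambda>E. nuc n (norm_mat n E)) \<le> (8 / (3 * pi) + 8 * d) * real n + K * sqrt (real n)"
    using avg_nuc_norm_mat_le[OF d(1,2)] by blast
  have "((\<lambda>n. K / sqrt (real n)) \<longlongrightarrow> 0) sequentially"
    by (intro real_tendsto_divide_at_top[OF tendsto_const] filterlim_compose[OF sqrt_at_top filterlim_real_sequentially])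
  then have "\<forall>\<^sub>F n in sequentially. K / sqrt (real n) < e / 2"
    using assms by (intro order_tendstoD) auto
  moreover have "\<forall>\<^sub>F n in sequentially. n \<ge> (1 :: nat)" by (rule eventually_ge_at_top)
  ultimately show ?thesis
  proof eventually_elim
    case (elim n)
    have pos: "sqrt (real n) > 0" "real n > 0" using elim by auto
    have "nuc n (sign_mat E) \<le> sqrt (real n) * nuc n (norm_mat n E)" for E
    proof -
      have "sign_mat E = (\<lambda>i j. sqrt (real n) * norm_mat n E i j)"
        using pos by (intro ext) (simp add: norm_mat_def)
      then show ?thesis using nuc_scale_le[of n "sqrt (real n)" "norm_mat n E"] by simp
    qed
    then have "avg (all_edges n) (\<lambda>E. nuc n (sign_mat E)) \<le> sqrt (real n) * avg (all_edges n) (\<lambda>E. nuc n (norm_mat n E))"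
      unfolding avg_cmult[symmetric] by (rule avg_mono)
    then have "mean_nuc n \<le> avg (all_edges n) (\<lambda>E. nuc n (norm_mat n E)) / real n"
      using pos by (simp add: mean_nuc_def field_simps)
    also have "\<dots> \<le> ((8 / (3 * pi) + 8 * d) * real n + K * sqrt (real n)) / real n"
      using K[OF elim(2)] by (intro divide_right_mono) auto
    also have "\<dots> = 8 / (3 * pi) + 8 * d + K * sqrt (real n) / real n"
      using pos by (simp add: add_divide_distrib)
    also have "K * sqrt (real n) / real n = K / sqrt (real n)"
      using pos by (simp add: field_simps)
    also have "8 / (3 * pi) + 8 * d + K / sqrt (real n) \<le> 8 / (3 * pi) + e"
      using elim d by linarith
    finally show ?case .
  qed
qed

section \<open>Bounded differences and tail bounds\<close>

lemma sum_abs_sign_mat_insert_le: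
  assumes "e \<in> all_edges n"
  shows "(\<Sum>i<n. \<Sum>j<n. \<bar>sign_mat (insert e E) i j - sign_mat E i j\<bar>) \<le> 4"
proof -
  obtain u v where e: "e = {u, v}" "u < n" "v < n" using assms by (auto simp: all_edges_def)
  \<comment> \<open>Only the entries \<open>(u, v)\<close> and \<open>(v, u)\<close> can change,
    each by at most 2.\<close>
  have "(\<Sum>i<n. \<Sum>j<n. \<bar>sign_mat (insert e E) i j - sign_mat E i j\<bar>) \<le>
      (\<Sum>i<n. \<Sum>j<n. 2 * (of_bool (i = u) * of_bool (j = v)) + 2 * (of_bool (i = v) * of_bool (j = u)))"
    by (intro sum_mono) (auto simp: sign_mat_def spin_def e doubleton_eq_iff)
  also have "\<dots> = 4"
    using e by (simp add: sum.distrib sum_distrib_left[symmetric] sum_distrib_right[symmetric] of_bool_def)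
  finally show ?thesis .
qed

lemma nuc_sign_mat_insert:
  assumes "e \<in> all_edges n"
  shows "\<bar>nuc n (sign_mat (insert e E)) - nuc n (sign_mat E)\<bar> \<le> 4"
proof -
  let ?D = "\<lambda>i j. sign_mat (insert e E) i j - sign_mat E i j"
  have "nuc n ?D \<le> 4"
    using nuc_le_sum_abs[of n ?D] sum_abs_sign_mat_insert_le[OF assms, of E] by linarith
  then show ?thesis
    using nuc_add_le[of n ?D "sign_mat E"] nuc_diff_le[of n "sign_mat (insert e E)" ?D] by simp
qed

text \<open>Stated for the negated sum because only upper tails are controlled, while the entry sum
  is needed from below.\<close>

lemma sum_sign_mat_insert:
  assumes "e \<in> all_edges n"
  shows "\<bar>- (\<Sum>i<n. \<Sum>j<n. sign_mat (insert e E) i j) - - (\<Sum>i<n. \<Sum>j<n. sign_mat E i j)\<bar> \<le> 4"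
proof -
  have "\<bar>- (\<Sum>i<n. \<Sum>j<n. sign_mat (insert e E) i j) - - (\<Sum>i<n. \<Sum>j<n. sign_mat E i j)\<bar> =
      \<bar>\<Sum>i<n. \<Sum>j<n. sign_mat (insert e E) i j - sign_mat E i j\<bar>"
    by (simp add: sum_subtractf)
  also have "\<dots> \<le> (\<Sum>i<n. \<bar>\<Sum>j<n. sign_mat (insert e E) i j - sign_mat E i j\<bar>)"
    by (rule sum_abs)
  also have "\<dots> \<le> (\<Sum>i<n. \<Sum>j<n. \<bar>sign_mat (insert e E) i j - sign_mat E i j\<bar>)"
    by (intro sum_mono sum_abs)
  finally show ?thesis using sum_abs_sign_mat_insert_le[OF assms, of E] by linarith
qed

lemma avg_sum_sign_mat: "avg (all_edges n) (\<lambda>E. - (\<Sum>i<n. \<Sum>j<n. sign_mat E i j)) = 0"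
proof -
  have "avg (all_edges n) (\<lambda>E. sign_mat E i j) = 0" if "i < n" "j < n" for i j
  proof (cases "i = j")
    case False
    then show ?thesis
      using avg_prod_spin[OF finite_all_edges, of "{{i, j}}" n] pair_in_all_edges[OF that] by (simp add: sign_mat_def)
  qed (simp add: sign_mat_def avg_const finite_all_edges)
  then have "(\<Sum>i<n. \<Sum>j<n. avg (all_edges n) (\<lambda>E. sign_mat E i j)) = 0" by simp
  then show ?thesis
    using avg_cmult[of "all_edges n" "-1" "\<lambda>E. \<Sum>i<n. \<Sum>j<n. sign_mat E i j"] by (simp add: avg_sum)
qed

text \<open>Differences of at most 4 over at most \<open>n\<^sup>2\<close> edges give variance at
  most \<open>4 * n\<^sup>2\<close>.\<close>

lemma prob_deviation_le:
  assumes "\<And>e E. e \<in> all_edges n \<Longrightarrow> \<bar>f (insert e E) - f E\<bar> \<le> 4" "t > 0"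
  shows "measure_pmf.prob (gnp_half n) {E. f E > avg (all_edges n) f + t} \<le> 4 * (real n)\<^sup>2 / t\<^sup>2"
proof -
  have "measure_pmf.prob (gnp_half n) {E. f E > avg (all_edges n) f + t} \<le> real (card (all_edges n)) * 4\<^sup>2 / (4 * t\<^sup>2)"
    unfolding gnp_half_def by (intro chebyshev_bounded_difference finite_all_edges assms)
  also have "\<dots> \<le> (real n)\<^sup>2 * 4\<^sup>2 / (4 * t\<^sup>2)"
    using card_all_edges_le[of n] by (intro divide_right_mono mult_right_mono) (simp_all flip: of_nat_power)
  finally show ?thesis by simp
qed

section \<open>From the nuclear norm of the sign matrix to \<open>rho_bar\<close>\<close>

lemma sigma1_admissible_ge:
  assumes "n \<ge> 1" "admissible n E M"
  shows "(real n)\<^sup>2 - real n + (\<Sum>i<n. \<Sum>j<n. sign_mat E i j) \<le> sigma1 n M * (2 * real n + nuc n (sign_mat E))"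
proof -
  \<comment> \<open>This is twice the adjacency matrix. An admissible \<open>M\<close> equals 1 on
    its support, so pairing with \<open>M\<close> gives the entry sum whatever \<open>M\<close> is
    on non-edges.\<close>
  define A where "A = (\<lambda>i j. 1 - id_mat i j + sign_mat E i j)"
  have entry: "M i j * A i j = A i j" if "i < n" "j < n" for i j
    using assms(2) that by (auto simp: A_def id_mat_def sign_mat_def spin_def admissible_def)
  have "(real n)\<^sup>2 - real n + (\<Sum>i<n. \<Sum>j<n. sign_mat E i j) = (\<Sum>i<n. \<Sum>j<n. A i j)"
    by (simp add: A_def sum.distrib sum_subtractf id_mat_def power2_eq_square right_diff_distrib)
  also have "\<dots> = frob_inner n M A"
    unfolding frob_inner_def by (intro sum.cong refl) (simp add: entry)
  also have "\<dots> \<le> sigma1 n M * nuc n A"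
    by (rule frob_inner_le_sigma1_nuc[OF assms(1)])
  also have "\<dots> \<le> sigma1 n M * (2 * real n + nuc n (sign_mat E))"
  proof (intro mult_left_mono sigma1_nonneg assms(1))
    have "nuc n A \<le> nuc n (\<lambda>i j. 1 - id_mat i j) + nuc n (sign_mat E)"
      unfolding A_def by (rule nuc_add_le)
    then show "nuc n A \<le> 2 * real n + nuc n (sign_mat E)"
      using nuc_diff_le[of n "\<lambda>i j. 1" id_mat] nuc_ones_le[of n] nuc_id_le[of n] by linarith
  qed
  finally show ?thesis .
qed

text \<open>Ensures that the infimum in \<open>rho_bar\<close> is over a nonempty set; the diagonal
  vanishes because \<open>all_edges n\<close> contains no singletons.\<close>

lemma admissible_exists:
  assumes "E \<subseteq> all_edges n"
  shows "admissible n E (\<lambda>i j. of_bool ({i, j} \<in> E))"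
proof -
  have "{i} \<notin> all_edges n" for i :: nat by (auto simp: all_edges_def doubleton_eq_iff)
  then show ?thesis using assms by (auto simp: admissible_def insert_commute)
qed

lemma rho_bar_ge:
  assumes n: "n \<ge> 1" and E: "E \<subseteq> all_edges n"
    and "nuc n (sign_mat E) \<le> u" "- (\<Sum>i<n. \<Sum>j<n. sign_mat E i j) \<le> v" "2 * real n + u > 0"
  shows "((real n)\<^sup>2 - real n - v) / (2 * real n + u) \<le> rho_bar n E"
  unfolding rho_bar_def
proof (rule cINF_greatest)
  show "{M. admissible n E M} \<noteq> {}" using admissible_exists[OF E] by blast
next
  fix M assume "M \<in> {M. admissible n E M}"
  then have "(real n)\<^sup>2 - real n + (\<Sum>i<n. \<Sum>j<n. sign_mat E i j) \<le> sigma1 n M * (2 * real n + nuc n (sign_mat E))"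
    using sigma1_admissible_ge[OF n] by simp
  also have "\<dots> \<le> sigma1 n M * (2 * real n + u)"
    using assms(3) by (intro mult_left_mono sigma1_nonneg n) simp
  finally show "((real n)\<^sup>2 - real n - v) / (2 * real n + u) \<le> sigma1 n M"
    using assms(4,5) by (simp add: pos_divide_le_eq)
qed

text \<open>Outside two deviation events, one for the nuclear norm and one for the number of edges,
  \<open>rho_bar_ge\<close> gives the bound; each event has probability at most
  \<open>4 * (ln n)\<^sup>2 / n\<close>.\<close>

lemma prob_rho_bar_ge:
  assumes n: "n \<ge> 3" and a: "a \<ge> mean_nuc n" "a > 0"
  shows "measure_pmf.prob (gnp_half n) {E. rho_bar n E \<ge>
      (1 - 1 / real n - 1 / sqrt (real n)) / (2 / sqrt (real n) + a + 1 / ln (real n)) * sqrt (real n)}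
    \<ge> 1 - 8 * (ln (real n))\<^sup>2 / real n"
proof -
  define s where "s = sqrt (real n)"
  define l where "l = ln (real n)"
  have s: "s > 0" "real n = s * s" using n by (auto simp: s_def)
  \<comment> \<open>The hypothesis \<open>n \<ge> 3\<close> serves to put \<open>n\<close> above
    Euler's number.\<close>
  have "exp 1 \<le> real n" using exp_le n by linarith
  then have l: "l \<ge> 1" unfolding l_def using n by (subst ln_ge_iff) auto
  define F where "F = (\<lambda>E. nuc n (sign_mat E))"
  define G where "G = (\<lambda>E. - (\<Sum>i<n. \<Sum>j<n. sign_mat E i j))"
  \<comment> \<open>The nuclear norm enters at scale \<open>s ^ 3\<close>, so its deviation must be
    of smaller order; dividing by \<open>l\<close> achieves this at the cost of
    \<open>l\<^sup>2\<close> in the probability. The entry sum is compared with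
    \<open>n\<^sup>2 = s ^ 4\<close>, so \<open>s ^ 3\<close> is small enough there.\<close>
  define X where "X = {E. F E > avg (all_edges n) F + s ^ 3 / l}"
  define Y where "Y = {E. G E > avg (all_edges n) G + s ^ 3}"
  define Z where "Z = {E. rho_bar n E \<ge> (1 - 1 / real n - 1 / s) / (2 / s + a + 1 / l) * s}"
  have "measure_pmf.prob (gnp_half n) X \<le> 4 * (real n)\<^sup>2 / (s ^ 3 / l)\<^sup>2"
    unfolding X_def F_def using s l by (intro prob_deviation_le nuc_sign_mat_insert) auto
  also have "\<dots> = 4 * l\<^sup>2 / real n"
    using s l by (simp add: field_simps power2_eq_square eval_nat_numeral)
  finally have PX: "measure_pmf.prob (gnp_half n) X \<le> 4 * l\<^sup>2 / real n" .
  have "measure_pmf.prob (gnp_half n) Y \<le> 4 * (real n)\<^sup>2 / (s ^ 3)\<^sup>2"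
    unfolding Y_def G_def using s by (intro prob_deviation_le sum_sign_mat_insert) auto
  also have "\<dots> = 4 * 1 / real n"
    using s by (simp add: field_simps power2_eq_square eval_nat_numeral)
  also have "\<dots> \<le> 4 * l\<^sup>2 / real n"
    using l by (intro divide_right_mono mult_left_mono) auto
  finally have PY: "measure_pmf.prob (gnp_half n) Y \<le> 4 * l\<^sup>2 / real n" .
  have sub: "Pow (all_edges n) - Z \<subseteq> X \<union> Y"
  proof
    fix E assume E: "E \<in> Pow (all_edges n) - Z"
    show "E \<in> X \<union> Y"
    proof (rule ccontr)
      assume "E \<notin> X \<union> Y"
      then have "F E \<le> avg (all_edges n) F + s ^ 3 / l" "G E \<le> s ^ 3"
        using avg_sum_sign_mat[of n] by (auto simp: X_def Y_def G_def)
      moreover have "avg (all_edges n) F \<le> a * s ^ 3"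
        using a(1) s by (simp add: mean_nuc_def F_def s_def[symmetric] field_simps eval_nat_numeral)
      ultimately have FG: "F E \<le> (a + 1 / l) * s ^ 3" "G E \<le> s ^ 3"
        by (simp_all add: algebra_simps)
      have pos: "2 * real n + (a + 1 / l) * s ^ 3 > 0"
        using s l a by (intro add_pos_pos mult_pos_pos) auto
      have "((real n)\<^sup>2 - real n - s ^ 3) / (2 * real n + (a + 1 / l) * s ^ 3) \<le> rho_bar n E"
        using n E FG pos unfolding F_def G_def by (intro rho_bar_ge) auto
      moreover have "((real n)\<^sup>2 - real n - s ^ 3) / (2 * real n + (a + 1 / l) * s ^ 3) =
          (1 - 1 / real n - 1 / s) / (2 / s + a + 1 / l) * s"
      proof -
        have "(real n)\<^sup>2 - real n - s ^ 3 = s ^ 4 * (1 - 1 / real n - 1 / s)"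
          using s by (simp add: field_simps power2_eq_square eval_nat_numeral)
        moreover have "2 * real n + (a + 1 / l) * s ^ 3 = s ^ 3 * (2 / s + a + 1 / l)"
          using s l by (simp add: field_simps eval_nat_numeral)
        moreover have "s ^ 4 / s ^ 3 = s"
          using s by (simp add: eval_nat_numeral)
        ultimately show ?thesis by (simp add: times_divide_times_eq[symmetric] mult.commute)
      qed
      ultimately show False using E by (simp add: Z_def)
    qed
  qed
  \<comment> \<open>The bound \<open>rho_bar_ge\<close> concerns subsets of
    \<open>all_edges n\<close>, so the failure event is first restricted to the support.\<close>
  have supp: "set_pmf (gnp_half n) = Pow (all_edges n)"
    unfolding gnp_half_def by (intro set_pmf_of_set) (auto simp: finite_all_edges)
  have "measure_pmf.prob (gnp_half n) (- Z) = measure_pmf.prob (gnp_half n) (- Z \<inter> set_pmf (gnp_half n))"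
    by (simp add: measure_Int_set_pmf)
  also have "\<dots> \<le> measure_pmf.prob (gnp_half n) (X \<union> Y)"
    using sub unfolding supp by (intro measure_pmf.finite_measure_mono) auto
  also have "\<dots> \<le> measure_pmf.prob (gnp_half n) X + measure_pmf.prob (gnp_half n) Y"
    by (rule measure_Un_le) auto
  also have "\<dots> \<le> 8 * l\<^sup>2 / real n" using PX PY by simp
  finally have "measure_pmf.prob (gnp_half n) (- Z) \<le> 8 * l\<^sup>2 / real n" .
  moreover have "measure_pmf.prob (gnp_half n) (- Z) = 1 - measure_pmf.prob (gnp_half n) Z"
    using measure_pmf.prob_compl[of Z "gnp_half n"] by (simp add: Compl_eq_Diff_UNIV)
  ultimately show ?thesis by (simp add: Z_def s_def l_def)
qed

theorem theoremD1:
  shows "\<exists>\<epsilon> :: nat \<Rightarrow> real. \<epsilon> \<longlonglongrightarrow> 0 \<and>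
    (\<exists>(C::real) (k::nat). \<forall>\<^sub>F n in sequentially.
       measure_pmf.prob (gnp_half n)
         {E. rho_bar n E \<ge> (3 * pi / 8 - \<epsilon> n) * sqrt (real n)}
       \<ge> 1 - C * (ln (real n)) ^ k / real n)"
proof -
  \<comment> \<open>Only an upper bound on \<open>mean_nuc\<close> is available; the maximum with
    the target value converges and stays positive.\<close>
  define a where "a = (\<lambda>n. max (mean_nuc n) (8 / (3 * pi)))"
  define b where "b = (\<lambda>n. (1 - 1 / real n - 1 / sqrt (real n)) / (2 / sqrt (real n) + a n + 1 / ln (real n)))"
  have a: "a \<longlonglongrightarrow> 8 / (3 * pi)"
  proof (rule order_tendstoI)
    fix y :: real assume "y < 8 / (3 * pi)"
    then show "\<forall>\<^sub>F n in sequentially. y < a n"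
      by (intro always_eventually) (auto simp: a_def less_max_iff_disj)
  next
    fix y assume y: "8 / (3 * pi) < y"
    then have "\<forall>\<^sub>F n in sequentially. mean_nuc n \<le> 8 / (3 * pi) + (y - 8 / (3 * pi)) / 2"
      by (intro eventually_mean_nuc_le) simp
    then show "\<forall>\<^sub>F n in sequentially. a n < y"
    proof eventually_elim
      case (elim n)
      then have "mean_nuc n < y" using y by argo
      then show ?case using y by (simp add: a_def)
    qed
  qed
  have lim: "(\<lambda>n. c / f (real n)) \<longlonglongrightarrow> 0" if "filterlim f at_top at_top" for f :: "real \<Rightarrow> real" and c
    by (intro real_tendsto_divide_at_top[OF tendsto_const] filterlim_compose[OF that filterlim_real_sequentially])
  \<comment> \<open>The limit is the reciprocal \<open>3 * pi / 8\<close> of the limit of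
    \<open>a\<close>.\<close>
  have "b \<longlonglongrightarrow> (1 - 0 - 0) / (0 + 8 / (3 * pi) + 0)"
    unfolding b_def
    by (intro tendsto_intros a lim lim[of "\<lambda>x. x"] sqrt_at_top ln_at_top filterlim_ident) auto
  then have "(\<lambda>n. 3 * pi / 8 - b n) \<longlonglongrightarrow> 3 * pi / 8 - 3 * pi / 8"
    by (intro tendsto_intros) simp
  moreover have "\<forall>\<^sub>F n in sequentially. measure_pmf.prob (gnp_half n)
      {E. rho_bar n E \<ge> (3 * pi / 8 - (3 * pi / 8 - b n)) * sqrt (real n)} \<ge> 1 - 8 * (ln (real n)) ^ 2 / real n"
    using eventually_ge_at_top[of 3]
  proof eventually_elim
    case (elim n)
    have "a n \<ge> mean_nuc n" "a n > 0" by (auto simp: a_def less_max_iff_disj)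
    from prob_rho_bar_ge[OF elim this] show ?case by (simp add: b_def)
  qed
  ultimately show ?thesis
    by (intro exI[of _ "\<lambda>n. 3 * pi / 8 - b n"] exI[of _ 8] exI[of _ 2] conjI) simp_all
qed

end
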